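(* Consider the regression model, prior and variational approximation $\tilde\pi_{n,\alpha}$ defined in the context. Fix $\alpha\in(0,1)$. Assume that there are $r\in[2,\infty)$ and $C>0$ such that $f_0\in\mathcal{W}(r,C^2)$. Then, as $n\to\infty$, $$\mathbb{E}\left[ \int D_{\alpha}(P_{f},P_{f_0})\, \tilde{\pi}_{n,\alpha}(\mathrm{d}f|X_1^n) \right] =\mathcal{O}\left( \left(\frac{\log(n)}{n}\right)^{\frac{2r}{2r+1}} \right).$$
   Context: Model. For a function $f:[-1,1]\to\mathbb{R}$, $P_f$ is the law of $(W,Y)$ with $W\sim\mathcal{U}([-1,1])$ and $Y=f(W)+\xi$, $\xi\sim\mathcal{N}(0,1)$ independent of $W$. The observations $X_i=(W_i,Y_i)$, $i=1,\dots,n$, are i.i.d. from $P_{f_0}$; $\mathbb{E}$ is the corresponding expectation. Trigonometric basis: $\varphi_1(t)=1$, $\varphi_{2k}(t)=\cos(\pi kt)$, $\varphi_{2k+1}(t)=\sin(\pi kt)$, $k=1,2,\dots$ Prior $\pi$ on functions: draw $K\ge1$ with $\pi(K=k)=2^{-k}$; given $K$, draw $\beta_1,\dots,\beta_K$ i.i.d. $\mathcal{N}(0,1)$; put $f=\sum_{k=1}^K\beta_k\varphi_k$. Variational family: for $K\ge1$, $\mathcal{F}_K$ is the set of laws $\rho_{\mathbf{m},s^2}$, $\mathbf{m}=(m_1,\dots,m_K)\in\mathbb{R}^K$, $s^2>0$, of functions $f=\sum_{k=1}^K\beta_k\varphi_k$ with $\beta_k\sim\mathcal{N}(m_k,s^2)$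 independent; $\mathcal{F}=\bigcup_{K\ge1}\mathcal{F}_K$. Variational approximation: $\tilde\pi_{n,\alpha}(\cdot|X_1^n)=\arg\min_{\rho\in\mathcal{F}}\left\{\alpha\int r_n(f,f_0)\rho(\mathrm{d}f)+\mathcal{K}(\rho,\pi)\right\}$ (any minimizer), where $r_n(f,f_0)=\sum_{i=1}^n\log\frac{p_{f_0}(X_i)}{p_f(X_i)}$ with $p_f$ the density of $P_f$, and $\mathcal{K}$ is the Kullback–Leibler divergence. Equivalently (dropping constants), one minimizes over $K\ge1$, $\mathbf{m}\in\mathbb{R}^K$, $s^2>0$ the quantity $$\frac{\alpha}{2} \sum_{i=1}^n \Bigl(Y_i - \sum_{k=1}^K m_k \varphi_k(W_i) \Bigr)^2 + \frac{s^2 \alpha}{2}\sum_{i=1}^n \sum_{k=1}^K \varphi^2_k(W_i) + \sum_{k=1}^K \frac{1}{2} \left[\log\left(\tfrac{1}{s^2}\right)+s^2+m_k^2-1\right] + K\log 2 .$$ Rényi divergence: $D_{\alpha}(P_{f},P_{f_0}) = \frac{1}{\alpha-1} \log \left[ \frac{1}{2} \int_{-1}^1 \exp\left(\frac{\alpha(\alpha-1)(f(x)-f_0(x))^2}{2}\right) \mathrm{d}x \right]$. Sobolev ellipsoid: $\mathcal{W}(r,C^2)=\left\{ f\in L_{2}([-1,1]): f=\sum_{k=1}^{\infty}\beta_k \varphi_k \text{ and } \sum_{k=1}^{\infty} k^{2r}\beta_{k}^{2} \leq C^2 \right\}$. The constant in $\mathcal{O}(\cdot)$ may depend on $\alpha$,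 $r$ and $C$. *)

theory Defs
  imports "HOL-Probability.Probability"
begin

section \<open>The regression model\<close>

text \<open>A function $[-1,1] \to \mathbb{R}$ is a term of type \<^typ>\<open>real \<Rightarrow> real\<close>; every measure on
  the design space lives on \<^term>\<open>{-1..1::real}\<close>, so values outside this interval are never used.\<close>

definition leb :: "real measure" where
  "leb = restrict_space lborel {-1..1}"

definition obs_law :: "(real \<Rightarrow> real) \<Rightarrow> (real \<times> real) measure" where
  "obs_law f = distr (uniform_measure leb {-1..1} \<Otimes>\<^sub>M density lborel std_normal_density)
     (leb \<Otimes>\<^sub>M lborel) (\<lambda>(w, \<xi>). (w, f w + \<xi>))"

text \<open>Density of \<^term>\<open>obs_law f\<close> with respect to Lebesgue measure on $[-1,1] \times \mathbb{R}$; see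
  \<open>obs_law_eq_density\<close>.\<close>

definition obs_density :: "(real \<Rightarrow> real) \<Rightarrow> real \<times> real \<Rightarrow> real" where
  "obs_density f = (\<lambda>(w, y). 1 / 2 * normal_density (f w) 1 y)"

definition sample_law :: "(real \<Rightarrow> real) \<Rightarrow> nat \<Rightarrow> (nat \<Rightarrow> real \<times> real) measure" where
  "sample_law f0 n = (\<Pi>\<^sub>M i\<in>{1..n}. obs_law f0)"

definition log_lik_ratio ::
    "nat \<Rightarrow> (nat \<Rightarrow> real \<times> real) \<Rightarrow> (real \<Rightarrow> real) \<Rightarrow> (real \<Rightarrow> real) \<Rightarrow> real" where
  "log_lik_ratio n X f f0 = (\<Sum>i=1..n. ln (obs_density f0 (X i) / obs_density f (X i)))"

text \<open>The Renyi divergence between \<^term>\<open>obs_law f\<close> and \<^term>\<open>obs_law f0\<close>; see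
  \<open>renyi_eq_density_integral\<close> for the expression in terms of densities.\<close>

definition renyi :: "real \<Rightarrow> (real \<Rightarrow> real) \<Rightarrow> (real \<Rightarrow> real) \<Rightarrow> real" where
  "renyi \<alpha> f f0 =
     1 / (\<alpha> - 1) * ln (1 / 2 * (\<integral>x. exp (\<alpha> * (\<alpha> - 1) * (f x - f0 x)\<^sup>2 / 2) \<partial>leb))"


section \<open>Trigonometric basis and Sobolev ellipsoids\<close>

text \<open>Indices start at 1; the value at index 0 is irrelevant.\<close>

definition trig :: "nat \<Rightarrow> real \<Rightarrow> real" where
  "trig k t =
     (if k = 1 then 1
      else if even k then cos (pi * real (k div 2) * t)
      else sin (pi * real (k div 2) * t))"

definition square_integrable :: "(real \<Rightarrow> real) \<Rightarrow> bool" where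
  "square_integrable f \<longleftrightarrow> f \<in> borel_measurable leb \<and> integrable leb (\<lambda>x. (f x)\<^sup>2)"

text \<open>The second argument is the squared radius. The expansion of \<open>f\<close> is understood in
  $L_2([-1,1])$.\<close>

definition sobolev_ellipsoid :: "real \<Rightarrow> real \<Rightarrow> (real \<Rightarrow> real) set" where
  "sobolev_ellipsoid r R = {f. square_integrable f \<and>
     (\<exists>\<beta> :: nat \<Rightarrow> real.
        (\<lambda>N. \<integral>x. (f x - (\<Sum>k=1..N. \<beta> k * trig k x))\<^sup>2 \<partial>leb) \<longlonglongrightarrow> 0 \<and>
        summable (\<lambda>k. real (Suc k) powr (2 * r) * (\<beta> (Suc k))\<^sup>2) \<and>
        (\<Sum>k. real (Suc k) powr (2 * r) * (\<beta> (Suc k))\<^sup>2) \<le> R)}"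


section \<open>Prior and variational approximation\<close>

text \<open>Random functions take values in the continuous functions on $[-1,1]$ with the
  sigma-algebra generated by the point evaluations. Without the restriction to continuous
  functions, \<^term>\<open>\<lambda>f. renyi \<alpha> f f0\<close> would not be measurable.\<close>

definition fun_space :: "(real \<Rightarrow> real) measure" where
  "fun_space = restrict_space (\<Pi>\<^sub>M t\<in>{-1..1}. borel) {f. continuous_on {-1..1} f}"

definition trig_sum :: "nat \<Rightarrow> (nat \<Rightarrow> real) \<Rightarrow> real \<Rightarrow> real" where
  "trig_sum K \<beta> = (\<lambda>t\<in>{-1..1}. \<Sum>k=1..K. \<beta> k * trig k t)"

definition gauss_law :: "nat \<Rightarrow> (nat \<Rightarrow> real) \<Rightarrow> real \<Rightarrow> (real \<Rightarrow> real) measure" where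
  "gauss_law K m v =
     distr (\<Pi>\<^sub>M k\<in>{1..K}. density lborel (normal_density (m k) (sqrt v))) fun_space (trig_sum K)"

text \<open>\<^term>\<open>geometric_pmf (1/2)\<close> counts failures starting from 0; shifting by one gives mass
  $2^{-k}$ at each $k \ge 1$.\<close>

definition dim_prior :: "nat pmf" where
  "dim_prior = map_pmf Suc (geometric_pmf (1 / 2))"

definition prior :: "(real \<Rightarrow> real) measure" where
  "prior = measure_pmf dim_prior \<bind> (\<lambda>K. gauss_law K (\<lambda>_. 0) 1)"

definition var_family :: "(real \<Rightarrow> real) measure set" where
  "var_family = (\<Union>K\<in>{1..}. {gauss_law K m v | m v. 0 < v})"

text \<open>\<^term>\<open>KL_divergence (exp 1) \<pi> \<rho>\<close> is the divergence of \<open>\<rho>\<close> from \<open>\<pi>\<close>: the library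
  integrates with respect to the last argument.\<close>

definition var_objective ::
    "real \<Rightarrow> (real \<Rightarrow> real) \<Rightarrow> nat \<Rightarrow> (nat \<Rightarrow> real \<times> real) \<Rightarrow> (real \<Rightarrow> real) measure \<Rightarrow> real" where
  "var_objective \<alpha> f0 n X \<rho> =
     \<alpha> * (\<integral>f. log_lik_ratio n X f f0 \<partial>\<rho>) + KL_divergence (exp 1) prior \<rho>"

definition is_var_approx ::
    "real \<Rightarrow> (real \<Rightarrow> real) \<Rightarrow> nat \<Rightarrow> (nat \<Rightarrow> real \<times> real) \<Rightarrow> (real \<Rightarrow> real) measure \<Rightarrow> bool" where
  "is_var_approx \<alpha> f0 n X \<rho> \<longleftrightarrow> is_arg_min (var_objective \<alpha> f0 n X) (\<lambda>\<rho>. \<rho> \<in> var_family) \<rho>"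


section \<open>Consistency of the definitions\<close>

lemma space_leb [simp]: "space leb = {-1..1}"
  by (simp add: leb_def space_restrict_space)

lemma emeasure_leb_space: "emeasure leb {-1..1} = 2"
  by (simp add: leb_def emeasure_restrict_space)

lemma sigma_finite_leb: "sigma_finite_measure leb"
  unfolding leb_def by (rule sigma_finite_measure_restrict_space) (auto intro: sigma_finite_lborel)

lemma pmf_dim_prior: "pmf dim_prior (Suc k) = (1 / 2) ^ Suc k"
  unfolding dim_prior_def by (subst pmf_map_inj') (auto simp: pmf_geometric)

lemma trig_measurable [measurable]: "trig k \<in> borel_measurable borel"
  unfolding trig_def[abs_def] by (cases "k = 1"; cases "even k") simp_all

lemma continuous_on_trig: "continuous_on S (trig k)"
  unfolding trig_def[abs_def]
  by (cases "k = 1"; cases "even k") (auto intro!: continuous_intros)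

lemma trig_sum_measurable:
  assumes "\<And>k. k \<in> {1..K} \<Longrightarrow> sets (M k) = sets borel"
  shows "trig_sum K \<in> measurable (\<Pi>\<^sub>M k\<in>{1..K}. M k) fun_space"
  unfolding fun_space_def
proof (rule measurable_restrict_space2)
  show "trig_sum K \<in> space (Pi\<^sub>M {1..K} M) \<rightarrow> {f. continuous_on {-1..1} f}"
  proof
    fix \<beta> :: "nat \<Rightarrow> real"
    have "continuous_on {-1..1} (\<lambda>t. \<Sum>k=1..K. \<beta> k * trig k t)"
      by (intro continuous_intros continuous_on_trig)
    then have "continuous_on {-1..1} (trig_sum K \<beta>)"
      by (rule continuous_on_eq) (simp add: trig_sum_def)
    then show "trig_sum K \<beta> \<in> {f. continuous_on {-1..1} f}" by simp
  qed
  have c: "(\<lambda>\<beta>. \<beta> k) \<in> borel_measurable (Pi\<^sub>M {1..K} M)" if "k \<in> {1..K}" for k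
    using measurable_component_singleton[OF that, of M] measurable_cong_sets[OF refl assms[OF that]]
    by blast
  show "trig_sum K \<in> measurable (Pi\<^sub>M {1..K} M) (\<Pi>\<^sub>M t\<in>{-1..1}. borel)"
    unfolding trig_sum_def[abs_def]
  proof (rule measurable_restrict)
    fix t :: real
    have "(\<lambda>\<beta>. \<beta> k * trig k t) \<in> borel_measurable (Pi\<^sub>M {1..K} M)" if "k \<in> {1..K}" for k
      using borel_measurable_times[OF c[OF that] borel_measurable_const] .
    then show "(\<lambda>\<beta>. \<Sum>k=1..K. \<beta> k * trig k t) \<in> borel_measurable (Pi\<^sub>M {1..K} M)"
      by (rule borel_measurable_sum)
  qed
qed

lemma sets_gauss_law [simp]: "sets (gauss_law K m v) = sets fun_space"
  by (simp add: gauss_law_def)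

lemma prob_space_gauss_law:
  assumes "0 < v"
  shows "prob_space (gauss_law K m v)"
proof -
  have "prob_space (\<Pi>\<^sub>M k\<in>{1..K}. density lborel (normal_density (m k) (sqrt v)))"
    by (intro prob_space_PiM prob_space_normal_density) (simp add: assms)
  then show ?thesis
    unfolding gauss_law_def
    by (rule prob_space.prob_space_distr[OF _ trig_sum_measurable]) simp
qed

lemma ennreal_inverse_two: "ennreal (1 / 2) = inverse 2"
  using inverse_ennreal[of 2] by (simp add: inverse_eq_divide)

lemma obs_law_eq_density:
  assumes f [measurable]: "f \<in> borel_measurable leb"
  shows "obs_law f = density (leb \<Otimes>\<^sub>M lborel) (obs_density f)"
proof -
  interpret L: sigma_finite_measure leb by (rule sigma_finite_leb)
  interpret N: prob_space "density lborel std_normal_density"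
    by (rule prob_space_normal_density) simp
  let ?U = "uniform_measure leb {-1..1}"
  let ?N = "density lborel std_normal_density"
  have leb_set [measurable]: "{-1..1} \<in> sets leb"
    using sets.top[of leb] by simp
  have map [measurable]: "(\<lambda>(w, \<xi>). (w, f w + \<xi>)) \<in> ?U \<Otimes>\<^sub>M ?N \<rightarrow>\<^sub>M leb \<Otimes>\<^sub>M lborel"
    by measurable
  have dens [measurable]: "obs_density f \<in> borel_measurable (leb \<Otimes>\<^sub>M lborel)"
    unfolding obs_density_def normal_density_def by measurable
  show ?thesis
  proof (rule measure_eqI)
    show "sets (obs_law f) = sets (density (leb \<Otimes>\<^sub>M lborel) (obs_density f))"
      by (simp add: obs_law_def)
  next
    fix A assume "A \<in> sets (obs_law f)"
    then have A [measurable]: "A \<in> sets (leb \<Otimes>\<^sub>M lborel)" by (simp add: obs_law_def)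
    have inner: "(\<integral>\<^sup>+\<xi>. indicator A (w, f w + \<xi>) \<partial>?N) =
        (\<integral>\<^sup>+y. ennreal (normal_density (f w) 1 y) * indicator A (w, y) \<partial>lborel)"
      if w: "w \<in> space leb" for w
    proof -
      define I :: "real \<Rightarrow> ennreal" where "I y = indicator A (w, y)" for y
      have I [measurable]: "I \<in> borel_measurable borel"
        using measurable_compose[OF measurable_Pair1'[OF w] borel_measurable_indicator[OF A]]
        unfolding I_def by (simp only: measurable_lborel2)
      define g where "g y = ennreal (normal_density (f w) 1 y) * I y" for y
      have g: "g \<in> borel_measurable borel"
        unfolding g_def normal_density_def
        by (intro borel_measurable_times_ennreal I measurable_compose[OF _ measurable_ennreal]
            borel_measurable_continuous_onI continuous_intros) simp
      have "(\<integral>\<^sup>+y. g y \<partial>lborel) = (\<integral>\<^sup>+y. g (f w + y) \<partial>lborel)"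
        using nn_integral_real_affine[OF g, of 1 "f w"] by simp
      also have "\<dots> = (\<integral>\<^sup>+y. ennreal (std_normal_density y) * I (f w + y) \<partial>lborel)"
        by (simp add: g_def normal_density_def)
      also have "\<dots> = (\<integral>\<^sup>+\<xi>. I (f w + \<xi>) \<partial>?N)"
        by (rule nn_integral_density[symmetric])
          (auto intro: measurable_compose[OF _ I])
      finally show ?thesis by (simp add: g_def I_def)
    qed
    have "emeasure (obs_law f) A
        = (\<integral>\<^sup>+z. indicator A ((\<lambda>(w, \<xi>). (w, f w + \<xi>)) z) \<partial>(?U \<Otimes>\<^sub>M ?N))"
      unfolding obs_law_def
      by (rule trans[OF nn_integral_indicator[symmetric] nn_integral_distr[OF map]])
        (simp_all only: sets_distr measurable_distr_eq1 A borel_measurable_indicator[OF A])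
    also have "\<dots> = (\<integral>\<^sup>+w. \<integral>\<^sup>+\<xi>. indicator A (w, f w + \<xi>) \<partial>?N \<partial>?U)"
      by (subst N.nn_integral_fst[symmetric]) simp_all
    also have "\<dots> = (\<integral>\<^sup>+w. \<integral>\<^sup>+y. ennreal (normal_density (f w) 1 y) * indicator A (w, y) \<partial>lborel \<partial>?U)"
      by (intro nn_integral_cong inner) simp
    also have "\<dots> = (\<integral>\<^sup>+w. \<integral>\<^sup>+y. ennreal (normal_density (f w) 1 y) * indicator A (w, y) \<partial>lborel \<partial>leb) / 2"
      by (subst nn_integral_uniform_measure)
        (auto simp: emeasure_leb_space normal_density_def intro!: arg_cong[where f = "\<lambda>x. x / 2"] nn_integral_cong)
    also have "\<dots> = (\<integral>\<^sup>+w. \<integral>\<^sup>+y. ennreal (obs_density f (w, y)) * indicator A (w, y) \<partial>lborel \<partial>leb)"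
    proof -
      have [measurable]: "indicator A \<in> borel_measurable (leb \<Otimes>\<^sub>M lborel)" by simp
      have half: "ennreal (obs_density f z) * indicator A z
          = ennreal (1 / 2) * (ennreal (normal_density (f (fst z)) 1 (snd z)) * indicator A z)" for z
        unfolding obs_density_def case_prod_beta
        by (subst ennreal_mult') (simp, simp only: mult.assoc)
      have m [measurable]: "(\<lambda>z. ennreal (normal_density (f (fst z)) 1 (snd z)) * indicator A z)
          \<in> borel_measurable (leb \<Otimes>\<^sub>M lborel)"
        unfolding normal_density_def by measurable
      have "(\<integral>\<^sup>+w. \<integral>\<^sup>+y. ennreal (obs_density f (w, y)) * indicator A (w, y) \<partial>lborel \<partial>leb)
          = (\<integral>\<^sup>+z. ennreal (obs_density f z) * indicator A z \<partial>(leb \<Otimes>\<^sub>M lborel))"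
        by (subst lborel.nn_integral_fst[symmetric]) simp_all
      also have "\<dots> = ennreal (1 / 2) *
          (\<integral>\<^sup>+z. ennreal (normal_density (f (fst z)) 1 (snd z)) * indicator A z \<partial>(leb \<Otimes>\<^sub>M lborel))"
        unfolding half by (rule nn_integral_cmult[OF m])
      also have "\<dots> = ennreal (1 / 2) *
          (\<integral>\<^sup>+w. \<integral>\<^sup>+y. ennreal (normal_density (f w) 1 y) * indicator A (w, y) \<partial>lborel \<partial>leb)"
        using lborel.nn_integral_fst[OF m] by simp
      finally show ?thesis
        using ennreal_inverse_two by (simp add: divide_ennreal_def mult.commute)
    qed
    also have "\<dots> = (\<integral>\<^sup>+z. ennreal (obs_density f z) * indicator A z \<partial>(leb \<Otimes>\<^sub>M lborel))"
      by (subst lborel.nn_integral_fst[symmetric]) simp_all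
    also have "\<dots> = emeasure (density (leb \<Otimes>\<^sub>M lborel) (obs_density f)) A"
      by (rule emeasure_density[symmetric, OF measurable_compose[OF dens measurable_ennreal] A])
    finally show "emeasure (obs_law f) A = emeasure (density (leb \<Otimes>\<^sub>M lborel) (obs_density f)) A" .
  qed
qed

lemma renyi_eq_density_integral:
  assumes f [measurable]: "f \<in> borel_measurable leb" "f0 \<in> borel_measurable leb"
    and \<alpha>: "0 < \<alpha>" "\<alpha> < 1"
  shows "renyi \<alpha> f f0 =
    1 / (\<alpha> - 1) * ln (\<integral>z. obs_density f z powr \<alpha> * obs_density f0 z powr (1 - \<alpha>) \<partial>(leb \<Otimes>\<^sub>M lborel))"
proof -
  interpret L: sigma_finite_measure leb by (rule sigma_finite_leb)
  let ?e = "\<lambda>x. exp (\<alpha> * (\<alpha> - 1) * (f x - f0 x)\<^sup>2 / 2)"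
  let ?c = "\<lambda>x. \<alpha> * f x + (1 - \<alpha>) * f0 x"
  have pw: "obs_density f (w, y) powr \<alpha> * obs_density f0 (w, y) powr (1 - \<alpha>)
      = 1 / 2 * ?e w * normal_density (?c w) 1 y" for w y
  proof -
    let ?k = "1 / 2 * (1 / sqrt (2 * pi))"
    have "?k powr \<alpha> * ?k powr (1 - \<alpha>) = ?k"
      by (subst powr_add[symmetric]) simp
    moreover have "\<alpha> * (- (y - f w)\<^sup>2 / 2) + (1 - \<alpha>) * (- (y - f0 w)\<^sup>2 / 2)
        = \<alpha> * (\<alpha> - 1) * (f w - f0 w)\<^sup>2 / 2 + - (y - ?c w)\<^sup>2 / 2"
      by (simp add: power2_eq_square field_simps)
    then have "exp (- (y - f w)\<^sup>2 / 2) powr \<alpha> * exp (- (y - f0 w)\<^sup>2 / 2) powr (1 - \<alpha>)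
        = ?e w * exp (- (y - ?c w)\<^sup>2 / 2)"
      by (simp only: exp_powr_real mult_exp_exp mult.commute)
    moreover have "obs_density f (w, y) = ?k * exp (- (y - f w)\<^sup>2 / 2)"
      "obs_density f0 (w, y) = ?k * exp (- (y - f0 w)\<^sup>2 / 2)"
      by (simp_all add: obs_density_def normal_density_def)
    then have "obs_density f (w, y) powr \<alpha> * obs_density f0 (w, y) powr (1 - \<alpha>)
      = (?k powr \<alpha> * ?k powr (1 - \<alpha>)) *
        (exp (- (y - f w)\<^sup>2 / 2) powr \<alpha> * exp (- (y - f0 w)\<^sup>2 / 2) powr (1 - \<alpha>))"
      by (simp only: powr_mult mult_ac) 
    ultimately show ?thesis by (simp add: normal_density_def)
  qed
  have "(\<integral>z. obs_density f z powr \<alpha> * obs_density f0 z powr (1 - \<alpha>) \<partial>(leb \<Otimes>\<^sub>M lborel))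
    = enn2real (\<integral>\<^sup>+z. ennreal (obs_density f z powr \<alpha> * obs_density f0 z powr (1 - \<alpha>)) \<partial>(leb \<Otimes>\<^sub>M lborel))"
    unfolding obs_density_def normal_density_def
    by (rule integral_eq_nn_integral) auto
  also have "(\<integral>\<^sup>+z. ennreal (obs_density f z powr \<alpha> * obs_density f0 z powr (1 - \<alpha>)) \<partial>(leb \<Otimes>\<^sub>M lborel))
    = (\<integral>\<^sup>+w. \<integral>\<^sup>+y. ennreal (obs_density f (w, y) powr \<alpha> * obs_density f0 (w, y) powr (1 - \<alpha>)) \<partial>lborel \<partial>leb)"
    unfolding obs_density_def normal_density_def
    by (subst lborel.nn_integral_fst[symmetric]) auto
  also have "\<dots> = (\<integral>\<^sup>+w. ennreal (1 / 2 * ?e w) \<partial>leb)"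
  proof (rule nn_integral_cong)
    fix w
    have "emeasure (density lborel (normal_density (?c w) 1)) (space lborel) = 1"
      using prob_space.emeasure_space_1[OF prob_space_normal_density[of 1 "?c w"]] by simp
    then have "(\<integral>\<^sup>+y. ennreal (normal_density (?c w) 1 y) \<partial>lborel) = 1"
      by (simp add: emeasure_density)
    then show "(\<integral>\<^sup>+y. ennreal (obs_density f (w, y) powr \<alpha> * obs_density f0 (w, y) powr (1 - \<alpha>)) \<partial>lborel)
      = ennreal (1 / 2 * ?e w)"
      unfolding pw by (subst ennreal_mult') (simp_all add: nn_integral_cmult del: times_divide_eq_left)
  qed
  also have "enn2real \<dots> = (\<integral>w. 1 / 2 * ?e w \<partial>leb)"
    by (rule integral_eq_nn_integral[symmetric]) auto
  also have "\<dots> = 1 / 2 * (\<integral>w. ?e w \<partial>leb)"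
    by (rule integral_mult_right_zero)
  finally show ?thesis by (simp only: renyi_def)
qed

end

theory Submission
  imports Defs
begin

text \<open>Write \<open>D\<close> for the Renyi divergence, \<open>r\<^sub>n\<close> for the log-likelihood ratio and \<open>d\<close> for the density of
  a member \<open>\<rho>\<close> of the variational family with respect to the prior. Integrating \<open>ln t \<le> t - 1\<close> at
  \<open>t = exp (n (1 - \<alpha>) D - \<alpha> r\<^sub>n) / d\<close> against \<open>\<rho>\<close> bounds \<open>n (1 - \<alpha>) \<integral> D d\<rho>\<close> by the variational
  objective of \<open>\<rho>\<close> plus \<open>Z - 1\<close>, where \<open>Z\<close> is the prior integral of \<open>exp (n (1 - \<alpha>) D - \<alpha> r\<^sub>n)\<close>.
  Since the expectation of \<open>Z\<close> is 1, the risk of any minimizer is at most the expected objective of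
  any fixed competitor. The competitor is the Gaussian law centred at the first \<open>K\<close> Fourier
  coefficients of the regression function with variance \<open>1 / n\<^sup>2\<close> and \<open>K\<close> of order
  \<open>(n / ln n) powr (1 / (2 r + 1))\<close>. The variance is this small because a crude Cauchy-Schwarz bound
  then suffices for the fluctuation around the centre, at no cost in the rate.\<close>

section \<open>Measurability of evaluation\<close>

lemma sets_leb: "sets leb = sets (restrict_space borel {-1..1})"
  unfolding leb_def by (rule sets_restrict_space_cong) simp

lemma finite_measure_leb: "finite_measure leb"
  by standard (simp add: emeasure_leb_space)

lemma space_fun_space: "space fun_space = extensional {-1..1} \<inter> {f. continuous_on {-1..1} f}"
  by (auto simp: fun_space_def space_restrict_space space_PiM PiE_def)

lemma measurable_leb_id: "(\<lambda>x. x) \<in> borel_measurable leb"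
  unfolding measurable_cong_sets[OF sets_leb refl] by (rule measurable_restrict_space1) simp

lemma borel_measurable_leb: "g \<in> borel_measurable borel \<Longrightarrow> g \<in> borel_measurable leb"
  by (rule measurable_compose[OF measurable_leb_id])

lemma continuous_imp_measurable_leb:
  "continuous_on {-1..1} g \<Longrightarrow> g \<in> borel_measurable leb" for g :: "real \<Rightarrow> real"
  unfolding measurable_cong_sets[OF sets_leb refl] by (rule borel_measurable_continuous_on_restrict)

lemma integrable_leb_continuous:
  fixes g :: "real \<Rightarrow> real"
  assumes "continuous_on {-1..1} g"
  shows "integrable leb g"
proof -
  interpret finite_measure leb by (rule finite_measure_leb)
  obtain B where "\<And>x. x \<in> {-1..1} \<Longrightarrow> norm (g x) \<le> B"
    using compact_imp_bounded[OF compact_continuous_image[OF assms compact_Icc]]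
    unfolding bounded_iff by (meson imageI)
  then show ?thesis
    by (intro integrable_const_bound[where B = B] AE_I2 continuous_imp_measurable_leb assms) simp
qed

lemma measurable_eval_point:
  assumes "t \<in> {-1..1}"
  shows "(\<lambda>f. f t) \<in> borel_measurable fun_space"
  unfolding fun_space_def
  by (intro measurable_restrict_space1 measurable_component_singleton assms)

text \<open>On continuous functions, evaluation is the pointwise limit of evaluations at
  finitely many grid points, hence jointly measurable.\<close>

lemma measurable_eval:
  assumes g: "g \<in> measurable M fun_space" and h: "h \<in> measurable M leb"
  shows "(\<lambda>x. g x (h x)) \<in> borel_measurable M"
proof (rule borel_measurable_LIMSEQ_real)
  \<comment> \<open>The grid point is \<open>h x\<close> rounded down to a multiple of
    \<open>1 / Suc j\<close>. Clamping leaves those points unchanged but puts \<open>q j i\<close>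
    into [-1,1] for every integer \<open>i\<close>, as \<open>measurable_eval_point\<close>
    demands.\<close>
  define q :: "nat \<Rightarrow> int \<Rightarrow> real" where "q j i = max (-1) (min 1 (real_of_int i / real (Suc j)))" for j i
  have h': "h \<in> borel_measurable M"
    using measurable_compose[OF h measurable_leb_id] .
  show "(\<lambda>x. g x (q j \<lfloor>h x * real (Suc j)\<rfloor>)) \<in> borel_measurable M" for j
  \<comment> \<open>The floor takes countably many values, so measurability can be checked with the
    grid index frozen.\<close>
  proof (rule measurable_compose_countable)
    fix i
    show "(\<lambda>x. g x (q j i)) \<in> borel_measurable M"
      by (rule measurable_compose[OF g measurable_eval_point]) (simp add: q_def)
  next
    have "(\<lambda>x. h x * real (Suc j)) \<in> borel_measurable M"
      using h' by (intro borel_measurable_times) auto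
    then show "(\<lambda>x. \<lfloor>h x * real (Suc j)\<rfloor>) \<in> measurable M (count_space UNIV)"
      using measurable_real_floor by (rule measurable_compose)
  qed
  fix x assume x: "x \<in> space M"
  have hx: "h x \<in> {-1..1}" using measurable_space[OF h x] by simp
  have cont: "continuous_on {-1..1} (g x)"
    using measurable_space[OF g x] by (simp add: space_fun_space)
  have "(\<lambda>j. q j \<lfloor>h x * real (Suc j)\<rfloor>) \<longlonglongrightarrow> h x"
  proof (rule tendsto_sandwich)
    have a: "h x - 1 / real (Suc j) \<le> real_of_int \<lfloor>h x * real (Suc j)\<rfloor> / real (Suc j)"
      "real_of_int \<lfloor>h x * real (Suc j)\<rfloor> / real (Suc j) \<le> h x" for j
    proof -
      have "h x * real (Suc j) - 1 \<le> real_of_int \<lfloor>h x * real (Suc j)\<rfloor>"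
        "real_of_int \<lfloor>h x * real (Suc j)\<rfloor> \<le> h x * real (Suc j)" by linarith+
      then show "h x - 1 / real (Suc j) \<le> real_of_int \<lfloor>h x * real (Suc j)\<rfloor> / real (Suc j)"
        "real_of_int \<lfloor>h x * real (Suc j)\<rfloor> / real (Suc j) \<le> h x"
        by (simp_all add: diff_divide_distrib[symmetric] pos_le_divide_eq pos_divide_le_eq
            left_diff_distrib del: of_nat_Suc)
    qed
    show "\<forall>\<^sub>F j in sequentially. h x - 1 / real (Suc j) \<le> q j \<lfloor>h x * real (Suc j)\<rfloor>"
    proof (rule always_eventually, rule allI)
      fix j
      have "0 < 1 / real (Suc j)" by simp
      then show "h x - 1 / real (Suc j) \<le> q j \<lfloor>h x * real (Suc j)\<rfloor>"
        using a[of j] hx unfolding q_def atLeastAtMost_iff by linarith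
    qed
    show "\<forall>\<^sub>F j in sequentially. q j \<lfloor>h x * real (Suc j)\<rfloor> \<le> h x"
      using a(2) hx by (auto simp: q_def min.coboundedI2 intro!: always_eventually simp del: of_nat_Suc)
    have "(\<lambda>j. h x - 1 / real (Suc j)) \<longlonglongrightarrow> h x - 0"
      by (intro tendsto_intros LIMSEQ_Suc lim_1_over_n)
    then show "(\<lambda>j. h x - 1 / real (Suc j)) \<longlonglongrightarrow> h x" by simp
  qed simp
  then show "(\<lambda>j. g x (q j \<lfloor>h x * real (Suc j)\<rfloor>)) \<longlonglongrightarrow> g x (h x)"
    by (rule continuous_on_tendsto_compose[OF cont _ hx]) (simp add: q_def)
qed

text \<open>Joint measurability of evaluation makes the integrand measurable on the product space,
  and integrating out the design variable preserves measurability. This serves both the Renyi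
  divergence and the Fourier coefficients.\<close>

lemma measurable_integral_eval:
  fixes \<Phi> :: "real \<Rightarrow> real \<Rightarrow> real"
  assumes "(\<lambda>(y, x). \<Phi> y x) \<in> borel_measurable (borel \<Otimes>\<^sub>M leb)"
  shows "(\<lambda>f. \<integral>x. \<Phi> (f x) x \<partial>leb) \<in> borel_measurable fun_space"
proof -
  interpret sigma_finite_measure leb by (rule sigma_finite_leb)
  have "(\<lambda>p. (fst p (snd p), snd p)) \<in> measurable (fun_space \<Otimes>\<^sub>M leb) (borel \<Otimes>\<^sub>M leb)"
    by (intro measurable_Pair measurable_eval measurable_fst measurable_snd)
  from measurable_compose[OF this assms]
  have "(\<lambda>(f, x). \<Phi> (f x) x) \<in> borel_measurable (fun_space \<Otimes>\<^sub>M leb)"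
    by (simp add: case_prod_beta)
  then show ?thesis
    using borel_measurable_lebesgue_integral[of "\<lambda>f x. \<Phi> (f x) x" fun_space] by blast
qed

lemma measurable_renyi:
  assumes "f0 \<in> borel_measurable leb"
  shows "(\<lambda>f. renyi \<alpha> f f0) \<in> borel_measurable fun_space"
proof -
  have "(\<lambda>(y, x). exp (\<alpha> * (\<alpha> - 1) * (y - f0 x)\<^sup>2 / 2)) \<in> borel_measurable (borel \<Otimes>\<^sub>M leb)"
    using assms by measurable
  from measurable_integral_eval[OF this] show ?thesis
    unfolding renyi_def by measurable
qed

section \<open>Orthogonality of the trigonometric basis\<close>

lemma integral_leb: "(\<integral>x. g x \<partial>leb) = (\<integral>x. g x * indicator {-1..1} x \<partial>lborel)" for g :: "real \<Rightarrow> real"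
  unfolding leb_def by (subst integral_restrict_space) (auto simp: mult.commute)

lemma integral_cos_leb:
  "(\<integral>t. cos (pi * real_of_int m * t) \<partial>leb) = (if m = 0 then 2 else 0)"
proof (cases "m = 0")
  case True
  have "measure leb {-1..1} = 2"
    by (simp add: measure_def emeasure_leb_space)
  with True show ?thesis by simp
next
  case False
  have "(\<integral>t. cos (pi * real_of_int m * t) * indicator {-1..1} t \<partial>lborel)
      = sin (pi * real_of_int m * 1) / (pi * real_of_int m) - sin (pi * real_of_int m * (-1)) / (pi * real_of_int m)"
    using False
    by (intro integral_FTC_Icc_real) (auto intro!: derivative_eq_intros)
  with False show ?thesis
    by (simp add: integral_leb sin_times_pi_eq_0 mult.commute[of pi])
qed

lemma integral_sin_leb: "(\<integral>t. sin (pi * real_of_int m * t) \<partial>leb) = 0"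
proof (cases "m = 0")
  case False
  have "(\<integral>t. sin (pi * real_of_int m * t) * indicator {-1..1} t \<partial>lborel)
      = - cos (pi * real_of_int m * 1) / (pi * real_of_int m) - - cos (pi * real_of_int m * (-1)) / (pi * real_of_int m)"
    using False
    by (intro integral_FTC_Icc_real) (auto intro!: derivative_eq_intros)
  with False show ?thesis by (simp add: integral_leb)
qed simp

text \<open>Product-to-sum formulas reduce everything to integrals of a cosine or sine of integer
  frequency \<open>a - b\<close> or \<open>a + b\<close>, which vanish except for the cosine of
  frequency 0. For the constant function both frequencies are 0 at once, hence its squared norm
  2.\<close>

lemma trig_orthogonal:
  assumes "1 \<le> j" "1 \<le> k"
  shows "(\<integral>t. trig j t * trig k t \<partial>leb) = (if j = k then if k = 1 then 2 else 1 else 0)"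
proof -
  define a b where "a = int (j div 2)" and "b = int (k div 2)"
  \<comment> \<open>The constant function is treated as the cosine of frequency 0, because
    \<open>1 div 2 = 0\<close>.\<close>
  have T: "trig j = (if j = 1 \<or> even j then (\<lambda>t. cos (pi * real_of_int a * t)) else (\<lambda>t. sin (pi * real_of_int a * t)))"
    "trig k = (if k = 1 \<or> even k then (\<lambda>t. cos (pi * real_of_int b * t)) else (\<lambda>t. sin (pi * real_of_int b * t)))"
    by (auto simp: trig_def a_def b_def fun_eq_iff)
  have int: "integrable leb (\<lambda>t. cos (pi * real_of_int m * t))"
    "integrable leb (\<lambda>t. sin (pi * real_of_int m * t))" for m
    by (auto intro!: integrable_leb_continuous continuous_intros)
  have cc: "cos (pi * real_of_int a * t) * cos (pi * real_of_int b * t)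
      = (cos (pi * real_of_int (a - b) * t) + cos (pi * real_of_int (a + b) * t)) / 2"
    and ss: "sin (pi * real_of_int a * t) * sin (pi * real_of_int b * t)
      = (cos (pi * real_of_int (a - b) * t) - cos (pi * real_of_int (a + b) * t)) / 2"
    and sc: "sin (pi * real_of_int a * t) * cos (pi * real_of_int b * t)
      = (sin (pi * real_of_int (a + b) * t) + sin (pi * real_of_int (a - b) * t)) / 2"
    and cs: "cos (pi * real_of_int a * t) * sin (pi * real_of_int b * t)
      = (sin (pi * real_of_int (a + b) * t) - sin (pi * real_of_int (a - b) * t)) / 2" for t
    unfolding cos_times_cos sin_times_sin sin_times_cos cos_times_sin
    by (simp_all only: of_int_add of_int_diff ring_distribs)
  have dj: "j = 2 * (j div 2) + j mod 2" "k = 2 * (k div 2) + k mod 2" by simp_all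
  show ?thesis
  proof (cases "j = 1 \<or> even j"; cases "k = 1 \<or> even k")
    assume jk: "j = 1 \<or> even j" "k = 1 \<or> even k"
    have eq: "a = b \<longleftrightarrow> j = k" "a + b = 0 \<longleftrightarrow> j = 1 \<and> k = 1"
      using jk dj assms by (auto simp: a_def b_def elim!: evenE)
    have "(\<integral>t. trig j t * trig k t \<partial>leb)
      = ((if a - b = 0 then 2 else 0) + (if a + b = 0 then 2 else 0)) / 2"
      unfolding T using jk by (simp only: if_True cc) (subst integral_divide_zero, subst Bochner_Integration.integral_add, (rule int)+, simp only: integral_cos_leb)
    then show ?thesis using eq by auto
  next
    assume jk: "\<not> (j = 1 \<or> even j)" "\<not> (k = 1 \<or> even k)"
    have eq: "a = b \<longleftrightarrow> j = k" "a + b \<noteq> 0" "k \<noteq> 1"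
      using jk assms by (simp_all add: a_def b_def) presburger+
    have "(\<integral>t. trig j t * trig k t \<partial>leb)
      = ((if a - b = 0 then 2 else 0) - (if a + b = 0 then 2 else 0)) / 2"
      unfolding T using jk by (simp only: if_False ss) (subst integral_divide_zero, subst Bochner_Integration.integral_diff, (rule int)+, simp only: integral_cos_leb)
    then show ?thesis using eq by auto
  next
    assume jk: "\<not> (j = 1 \<or> even j)" "k = 1 \<or> even k"
    have "(\<integral>t. trig j t * trig k t \<partial>leb) = 0"
      unfolding T using jk by (simp only: if_True if_False sc) (subst integral_divide_zero, subst Bochner_Integration.integral_add, (rule int)+, simp only: integral_sin_leb, simp)
    then show ?thesis using jk by auto
  next
    assume jk: "j = 1 \<or> even j" "\<not> (k = 1 \<or> even k)"
    have "(\<integral>t. trig j t * trig k t \<partial>leb) = 0"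
      unfolding T using jk by (simp only: if_True if_False cs) (subst integral_divide_zero, subst Bochner_Integration.integral_diff, (rule int)+, simp only: integral_sin_leb, simp)
    then show ?thesis using jk by auto
  qed
qed

section \<open>The density of the variational family with respect to the prior\<close>

text \<open>The Fourier coefficient; the divisor is the squared norm of \<open>trig k\<close> on
  [-1,1].\<close>

definition trig_coef :: "nat \<Rightarrow> (real \<Rightarrow> real) \<Rightarrow> real" where
  "trig_coef k f = (\<integral>x. f x * trig k x \<partial>leb) / (if k = 1 then 2 else 1)"

lemma measurable_trig_coef: "trig_coef k \<in> borel_measurable fun_space"
proof -
  have [measurable]: "trig k \<in> borel_measurable leb"
    by (intro borel_measurable_leb trig_measurable)
  have "(\<lambda>(y, x). y * trig k x) \<in> borel_measurable (borel \<Otimes>\<^sub>M leb)"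
    by measurable
  from measurable_integral_eval[OF this] show ?thesis
    unfolding trig_coef_def[abs_def] by measurable
qed

lemma integrable_trig_mult: "integrable leb (\<lambda>x. trig j x * trig k x)"
  by (intro integrable_leb_continuous continuous_intros continuous_on_trig)

text \<open>By orthogonality the coefficients can be read off from the random function they
  generate, so densities can be transported from coefficient vectors to functions.\<close>

lemma trig_coef_trig_sum:
  assumes "1 \<le> k"
  shows "trig_coef k (trig_sum K b) = (if k \<le> K then b k else 0)"
proof -
  have "(\<integral>x. trig_sum K b x * trig k x \<partial>leb) = (\<integral>x. (\<Sum>j=1..K. b j * (trig j x * trig k x)) \<partial>leb)"
    by (intro Bochner_Integration.integral_cong) (auto simp: trig_sum_def sum_distrib_right mult.assoc)
  also have "\<dots> = (\<Sum>j=1..K. b j * (\<integral>x. trig j x * trig k x \<partial>leb))"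
    by (subst Bochner_Integration.integral_sum) (auto intro: integrable_trig_mult)
  also have "\<dots> = (\<Sum>j=1..K. if j = k then b k * (if k = 1 then 2 else 1) else 0)"
    using assms by (intro sum.cong) (auto simp: trig_orthogonal)
  finally show ?thesis
    using assms by (simp add: trig_coef_def)
qed

section \<open>Gaussian laws of coefficient vectors and their densities\<close>

definition coef_law :: "nat \<Rightarrow> (nat \<Rightarrow> real) \<Rightarrow> real \<Rightarrow> (nat \<Rightarrow> real) measure" where
  "coef_law K m v = (\<Pi>\<^sub>M k\<in>{1..K}. density lborel (normal_density (m k) (sqrt v)))"

lemma gauss_law_eq_distr: "gauss_law K m v = distr (coef_law K m v) fun_space (trig_sum K)"
  by (simp add: gauss_law_def coef_law_def)

lemma measurable_trig_sum_coef_law: "trig_sum K \<in> measurable (coef_law K m v) fun_space"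
  unfolding coef_law_def by (rule trig_sum_measurable) simp

lemma prob_space_coef_law: "0 < v \<Longrightarrow> prob_space (coef_law K m v)"
  unfolding coef_law_def by (intro prob_space_PiM prob_space_normal_density) simp

lemma distr_coef_law:
  assumes "0 < v" "k \<in> {1..K}"
  shows "distr (coef_law K m v) (density lborel (normal_density (m k) (sqrt v))) (\<lambda>b. b k)
    = density lborel (normal_density (m k) (sqrt v))"
  unfolding coef_law_def using assms
  by (intro distr_PiM_component prob_space_normal_density) auto

text \<open>Both sides agree on boxes: there the indicator splits into coordinate indicators and the
  integral of a product factorises.\<close>

lemma PiM_density:
  fixes M :: "'i \<Rightarrow> 'a measure"
  assumes I: "finite I"
    and M: "\<And>i. sigma_finite_measure (M i)"
    and D: "\<And>i. sigma_finite_measure (density (M i) (f i))"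
    and f [measurable]: "\<And>i. f i \<in> borel_measurable (M i)"
  shows "PiM I (\<lambda>i. density (M i) (f i)) = density (PiM I M) (\<lambda>x. \<Prod>i\<in>I. f i (x i))"
proof -
  interpret M: product_sigma_finite M unfolding product_sigma_finite_def using M by blast
  interpret D: product_sigma_finite "\<lambda>i. density (M i) (f i)"
    unfolding product_sigma_finite_def using D by blast
  have [measurable]: "(\<lambda>x. \<Prod>i\<in>I. f i (x i)) \<in> borel_measurable (PiM I M)"
    by measurable
  show ?thesis
  proof (rule D.PiM_eqI[OF I, symmetric])
    show "sets (density (PiM I M) (\<lambda>x. \<Prod>i\<in>I. f i (x i))) = sets (PiM I (\<lambda>i. density (M i) (f i)))"
      by (simp cong: sets_PiM_cong)
    fix A assume "\<And>i. i \<in> I \<Longrightarrow> A i \<in> sets (density (M i) (f i))"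
    then have A [measurable]: "\<And>i. i \<in> I \<Longrightarrow> A i \<in> sets (M i)" by simp
    have "emeasure (density (PiM I M) (\<lambda>x. \<Prod>i\<in>I. f i (x i))) (Pi\<^sub>E I A)
        = (\<integral>\<^sup>+x. (\<Prod>i\<in>I. f i (x i)) * indicator (Pi\<^sub>E I A) x \<partial>PiM I M)"
      by (rule emeasure_density) (use I A in \<open>auto intro!: sets_PiM_I_finite\<close>)
    also have "\<dots> = (\<integral>\<^sup>+x. (\<Prod>i\<in>I. f i (x i) * indicator (A i) (x i)) \<partial>PiM I M)"
    proof (rule nn_integral_cong)
      fix x assume "x \<in> space (PiM I M)"
      then have "indicator (Pi\<^sub>E I A) x = (\<Prod>i\<in>I. indicator (A i) (x i) :: ennreal)"
        using I by (auto simp: indicator_def PiE_iff space_PiM prod_zero_iff)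
      then show "(\<Prod>i\<in>I. f i (x i)) * indicator (Pi\<^sub>E I A) x
          = (\<Prod>i\<in>I. f i (x i) * indicator (A i) (x i))"
        by (simp add: prod.distrib)
    qed
    also have "\<dots> = (\<Prod>i\<in>I. \<integral>\<^sup>+x. f i x * indicator (A i) x \<partial>M i)"
      by (rule M.product_nn_integral_prod[OF I]) measurable
    also have "\<dots> = (\<Prod>i\<in>I. emeasure (density (M i) (f i)) (A i))"
      by (intro prod.cong refl emeasure_density[symmetric]) auto
    finally show "emeasure (density (PiM I M) (\<lambda>x. \<Prod>i\<in>I. f i (x i))) (Pi\<^sub>E I A)
        = (\<Prod>i\<in>I. emeasure (density (M i) (f i)) (A i))" .
  qed
qed

abbreviation normal_ratio :: "real \<Rightarrow> real \<Rightarrow> real \<Rightarrow> real" where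
  "normal_ratio \<mu> v x \<equiv> normal_density \<mu> (sqrt v) x / std_normal_density x"

lemma coef_law_eq_density:
  assumes "0 < v"
  shows "coef_law K m v
    = density (coef_law K (\<lambda>_. 0) 1) (\<lambda>b. ennreal (\<Prod>k=1..K. normal_ratio (m k) v (b k)))"
proof -
  let ?N = "\<lambda>_::nat. density lborel std_normal_density"
  have eq: "density lborel (normal_density (m k) (sqrt v))
      = density (?N k) (\<lambda>x. ennreal (normal_ratio (m k) v x))" for k
  proof -
    have "std_normal_density x * normal_ratio (m k) v x = normal_density (m k) (sqrt v) x" for x
      using normal_density_pos[of 1 0 x] by simp
    then show ?thesis
      by (subst density_density_eq) (auto simp flip: ennreal_mult')
  qed
  have "sigma_finite_measure (density (?N k) (\<lambda>x. ennreal (normal_ratio (m k) v x)))" for k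
    unfolding eq[symmetric] using assms
    by (intro prob_space_imp_sigma_finite prob_space_normal_density) simp
  moreover have "sigma_finite_measure (?N k)" for k
    by (intro prob_space_imp_sigma_finite prob_space_normal_density) simp
  ultimately have "coef_law K m v
      = density (PiM {1..K} ?N) (\<lambda>b. \<Prod>k=1..K. ennreal (normal_ratio (m k) v (b k)))"
    unfolding coef_law_def eq by (intro PiM_density) auto
  then show ?thesis
    by (simp add: coef_law_def prod_ennreal)
qed

text \<open>Functions whose last nonzero coefficient has index \<open>K\<close>. Distinct
  \<open>K\<close> give disjoint sets, and for \<open>K \<ge> 1\<close> the law
  \<open>gauss_law K m v\<close> is carried by the \<open>K\<close>-th one; this separates the
  components of the mixture prior.\<close>

definition exact_dim :: "nat \<Rightarrow> (real \<Rightarrow> real) set" where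
  "exact_dim K = {f \<in> space fun_space. trig_coef K f \<noteq> 0 \<and> (\<forall>k>K. trig_coef k f = 0)}"

lemma sets_exact_dim [measurable]: "exact_dim K \<in> sets fun_space"
proof -
  note measurable_trig_coef [measurable]
  show ?thesis unfolding exact_dim_def by measurable
qed

lemma exact_dim_unique: "f \<in> exact_dim j \<Longrightarrow> f \<in> exact_dim k \<Longrightarrow> j = k"
  unfolding exact_dim_def by (cases j k rule: linorder_cases) auto

text \<open>The last coefficient has a Lebesgue density, so it vanishes with probability 0.\<close>

lemma AE_coef_law_exact_dim:
  assumes "0 < v" "1 \<le> K"
  shows "AE b in coef_law K m v. trig_sum K b \<in> exact_dim K"
proof -
  have "AE x in density lborel (normal_density (m K) (sqrt v)). x \<noteq> 0"
    using AE_lborel_singleton[of "0::real"] by (subst AE_density) auto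
  then have "AE b in coef_law K m v. b K \<noteq> 0"
    unfolding coef_law_def using assms
    by (intro AE_PiM_component[where P = "\<lambda>x. x \<noteq> 0"] prob_space_normal_density) auto
  moreover have "AE b in coef_law K m v. b \<in> space (coef_law K m v)" by simp
  ultimately show ?thesis
  proof eventually_elim
    case (elim b)
    then show ?case
      using assms measurable_space[OF measurable_trig_sum_coef_law]
      by (auto simp: exact_dim_def trig_coef_trig_sum)
  qed
qed

lemma AE_gauss_law_exact_dim:
  assumes "0 < v" "1 \<le> K"
  shows "AE f in gauss_law K m v. f \<in> exact_dim K"
  unfolding gauss_law_eq_distr
proof (subst AE_distr_iff[OF measurable_trig_sum_coef_law])
  have "{x \<in> space fun_space. x \<in> exact_dim K} = exact_dim K"
    by (auto simp: exact_dim_def)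
  then show "{x \<in> space fun_space. x \<in> exact_dim K} \<in> sets fun_space" by simp
qed (rule AE_coef_law_exact_dim[OF assms])

section \<open>The prior as a mixture over dimensions\<close>

lemma measurable_gauss_law:
  "(\<lambda>K. gauss_law K (\<lambda>_. 0) 1) \<in> measurable (measure_pmf p) (subprob_algebra fun_space)"
  by (auto simp: space_subprob_algebra prob_space_gauss_law prob_space_imp_subprob_space)

lemma sets_prior [simp]: "sets prior = sets fun_space"
  unfolding prior_def by (rule sets_bind) auto

lemma space_prior [simp]: "space prior = space fun_space"
  by (rule sets_eq_imp_space_eq) simp

lemma nn_integral_prior:
  "F \<in> borel_measurable fun_space \<Longrightarrow>
    (\<integral>\<^sup>+f. F f \<partial>prior) = (\<integral>\<^sup>+K. \<integral>\<^sup>+f. F f \<partial>gauss_law K (\<lambda>_. 0) 1 \<partial>measure_pmf dim_prior)"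
  unfolding prior_def by (rule nn_integral_bind[OF _ measurable_gauss_law])

lemma prob_space_prior: "prob_space prior"
  unfolding prior_def
  by (rule prob_space.prob_space_bind[OF measure_pmf.prob_space_axioms _ measurable_gauss_law])
    (simp add: prob_space_gauss_law)

text \<open>The factor \<open>2 ^ K\<close> is the inverse of the prior mass of dimension
  \<open>K\<close>; the indicator removes the mixture components of all other dimensions.\<close>

definition gauss_prior_density :: "nat \<Rightarrow> (nat \<Rightarrow> real) \<Rightarrow> real \<Rightarrow> (real \<Rightarrow> real) \<Rightarrow> real" where
  "gauss_prior_density K m v f =
     2 ^ K * (\<Prod>k=1..K. normal_ratio (m k) v (trig_coef k f)) * indicator (exact_dim K) f"

lemma measurable_gauss_prior_density [measurable]:
  "gauss_prior_density K m v \<in> borel_measurable fun_space"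
proof -
  note measurable_trig_coef [measurable]
  show ?thesis unfolding gauss_prior_density_def[abs_def] by measurable
qed

lemma gauss_prior_density_nonneg: "0 \<le> gauss_prior_density K m v f"
  unfolding gauss_prior_density_def by (intro mult_nonneg_nonneg prod_nonneg) auto

lemma gauss_prior_density_trig_sum:
  "trig_sum K b \<in> exact_dim K \<Longrightarrow>
    gauss_prior_density K m v (trig_sum K b) = 2 ^ K * (\<Prod>k=1..K. normal_ratio (m k) v (b k))"
  unfolding gauss_prior_density_def by (auto simp: trig_coef_trig_sum intro!: prod.cong)

text \<open>Integrated against the mixture, the candidate density kills every component except the
  \<open>K\<close>-th. That one has weight \<open>(1 / 2) ^ K\<close>, which \<open>2 ^ K\<close>
  cancels, and what remains is the change of variance and mean in
  \<open>coef_law_eq_density\<close>.\<close>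

lemma gauss_law_eq_density:
  assumes v: "0 < v" and K: "1 \<le> K"
  shows "gauss_law K m v = density prior (gauss_prior_density K m v)"
proof (rule measure_eqI)
  show "sets (gauss_law K m v) = sets (density prior (gauss_prior_density K m v))" by simp
  fix A assume "A \<in> sets (gauss_law K m v)"
  then have A [measurable]: "A \<in> sets fun_space" by simp
  let ?G = "\<lambda>f. ennreal (gauss_prior_density K m v f) * indicator A f"
  let ?R = "\<lambda>b. \<Prod>k=1..K. normal_ratio (m k) v (b k)"
  note measurable_trig_sum_coef_law [measurable]
  have G: "?G \<in> borel_measurable fun_space" by measurable
  \<comment> \<open>A draw of dimension \<open>j\<close> almost surely has exact dimension
    \<open>j\<close>, where the density for \<open>K\<close> is 0.\<close>
  have other: "(\<integral>\<^sup>+f. ?G f \<partial>gauss_law j (\<lambda>_. 0) 1) = 0" if j: "j \<in> set_pmf dim_prior" "j \<noteq> K" for j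
  proof -
    have "1 \<le> j" using j by (auto simp: dim_prior_def)
    then have "AE f in gauss_law j (\<lambda>_. 0) 1. ?G f = 0"
      using AE_gauss_law_exact_dim[of 1 j "\<lambda>_. 0"] j exact_dim_unique[of _ j K]
      by (auto simp: gauss_prior_density_def indicator_def elim!: eventually_mono)
    then show ?thesis
      by (subst nn_integral_0_iff_AE) (use G in \<open>auto simp: measurable_cong_sets[OF sets_gauss_law refl]\<close>)
  qed
  have R: "(\<lambda>b. ennreal (?R b)) \<in> borel_measurable (coef_law K (\<lambda>_. 0) 1)"
    unfolding coef_law_def by measurable
  have "(\<integral>\<^sup>+f. ?G f \<partial>gauss_law K (\<lambda>_. 0) 1)
      = (\<integral>\<^sup>+b. ?G (trig_sum K b) \<partial>coef_law K (\<lambda>_. 0) 1)"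
    unfolding gauss_law_eq_distr by (rule nn_integral_distr) (use G in auto)
  also have "\<dots> = (\<integral>\<^sup>+b. 2 ^ K * (ennreal (?R b) * indicator A (trig_sum K b)) \<partial>coef_law K (\<lambda>_. 0) 1)"
  proof (rule nn_integral_cong_AE)
    have "AE b in coef_law K (\<lambda>_. 0) 1. trig_sum K b \<in> exact_dim K"
      using K by (intro AE_coef_law_exact_dim) simp
    then show "AE b in coef_law K (\<lambda>_. 0) 1. ?G (trig_sum K b)
        = 2 ^ K * (ennreal (?R b) * indicator A (trig_sum K b))"
    proof eventually_elim
      case (elim b)
      have "0 \<le> ?R b" by (intro prod_nonneg) auto
      then show ?case
        by (simp only: gauss_prior_density_trig_sum[OF elim] ennreal_mult' ennreal_power[symmetric] mult.assoc)
          (simp add: ennreal_mult' ennreal_power[symmetric] mult.assoc)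
    qed
  qed
  also have "\<dots> = 2 ^ K * (\<integral>\<^sup>+b. ennreal (?R b) * indicator A (trig_sum K b) \<partial>coef_law K (\<lambda>_. 0) 1)"
    by (rule nn_integral_cmult) (use R in measurable)
  also have "(\<integral>\<^sup>+b. ennreal (?R b) * indicator A (trig_sum K b) \<partial>coef_law K (\<lambda>_. 0) 1)
      = (\<integral>\<^sup>+b. indicator A (trig_sum K b) \<partial>coef_law K m v)"
    unfolding coef_law_eq_density[OF v, of K m]
    by (rule nn_integral_density[symmetric]) (use R in measurable)
  also have "\<dots> = (\<integral>\<^sup>+f. indicator A f \<partial>gauss_law K m v)"
    unfolding gauss_law_eq_distr by (rule nn_integral_distr[symmetric]) auto
  also have "\<dots> = emeasure (gauss_law K m v) A" by simp
  finally have same: "(\<integral>\<^sup>+f. ?G f \<partial>gauss_law K (\<lambda>_. 0) 1) = 2 ^ K * emeasure (gauss_law K m v) A" .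
  have "emeasure (density prior (gauss_prior_density K m v)) A = (\<integral>\<^sup>+f. ?G f \<partial>prior)"
    by (rule emeasure_density) (auto simp: measurable_cong_sets[OF sets_prior refl])
  also have "\<dots> = (\<integral>\<^sup>+j. \<integral>\<^sup>+f. ?G f \<partial>gauss_law j (\<lambda>_. 0) 1 \<partial>measure_pmf dim_prior)"
    by (rule nn_integral_prior[OF G])
  also have "\<dots> = (\<integral>\<^sup>+j. (2 ^ K * emeasure (gauss_law K m v) A) * indicator {K} j \<partial>measure_pmf dim_prior)"
  proof (intro nn_integral_cong_AE AE_pmfI)
    fix j assume "j \<in> set_pmf dim_prior"
    then show "(\<integral>\<^sup>+f. ?G f \<partial>gauss_law j (\<lambda>_. 0) 1) = (2 ^ K * emeasure (gauss_law K m v) A) * indicator {K} j"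
      using same other[of j] by (cases "j = K") simp_all
  qed
  also have "\<dots> = 2 ^ K * emeasure (gauss_law K m v) A * ennreal ((1 / 2) ^ K)"
    using K pmf_dim_prior[of "K - 1"] by (simp add: emeasure_pmf_single)
  also have "\<dots> = ennreal (2 ^ K * (1 / 2) ^ K) * emeasure (gauss_law K m v) A"
    by (simp add: ennreal_mult' ennreal_power[symmetric] mult_ac)
  also have "\<dots> = emeasure (gauss_law K m v) A"
    by (simp flip: power_mult_distrib)
  finally show "emeasure (gauss_law K m v) A = emeasure (density prior (gauss_prior_density K m v)) A" ..
qed

section \<open>Gaussian moments and the Kullback-Leibler term\<close>

lemma abs_trig_le_1: "\<bar>trig k t\<bar> \<le> 1"
  by (simp add: trig_def)

context
  fixes v :: real
  assumes v: "0 < v"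
begin

lemma normal_centered_moments:
  fixes \<mu> :: real
  defines "N \<equiv> density lborel (normal_density \<mu> (sqrt v))"
  shows "integrable N (\<lambda>x. x - \<mu>)" "(\<integral>x. x - \<mu> \<partial>N) = 0"
    "integrable N (\<lambda>x. (x - \<mu>)\<^sup>2)" "(\<integral>x. (x - \<mu>)\<^sup>2 \<partial>N) = v"
proof -
  have s: "0 < sqrt v" using v by simp
  show "integrable N (\<lambda>x. x - \<mu>)"
    using integrable_normal_moment[OF s, of \<mu> 1] unfolding N_def by (subst integrable_density) auto
  show "integrable N (\<lambda>x. (x - \<mu>)\<^sup>2)"
    using integrable_normal_moment[OF s, of \<mu> 2] unfolding N_def by (subst integrable_density) auto
  show "(\<integral>x. x - \<mu> \<partial>N) = 0"
    using integral_normal_moment_odd[OF s, of \<mu> 0] unfolding N_def by (subst integral_density) auto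
  show "(\<integral>x. (x - \<mu>)\<^sup>2 \<partial>N) = v"
    using integral_normal_moment_even[OF s, of \<mu> 1] v unfolding N_def
    by (subst integral_density) auto
qed

lemma coef_law_coordinate:
  fixes g :: "real \<Rightarrow> real"
  assumes k: "k \<in> {1..K}" and g: "integrable (density lborel (normal_density (m k) (sqrt v))) g"
  shows "integrable (coef_law K m v) (\<lambda>b. g (b k))"
    "(\<integral>b. g (b k) \<partial>coef_law K m v) = (\<integral>x. g x \<partial>density lborel (normal_density (m k) (sqrt v)))"
proof -
  let ?N = "density lborel (normal_density (m k) (sqrt v))"
  have meas: "(\<lambda>b. b k) \<in> measurable (coef_law K m v) ?N"
    unfolding coef_law_def using k by measurable
  note eq = distr_coef_law[OF v k, of m]
  show "integrable (coef_law K m v) (\<lambda>b. g (b k))"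
    using integrable_distr_eq[OF meas borel_measurable_integrable[OF g]] g eq by simp
  show "(\<integral>b. g (b k) \<partial>coef_law K m v) = integral\<^sup>L ?N g"
    using integral_distr[OF meas borel_measurable_integrable[OF g]] eq by simp
qed

text \<open>Expanded in powers of \<open>x - \<mu>\<close>, so that its mean needs only the first
  two centred moments.\<close>

lemma ln_normal_ratio:
  "ln (normal_ratio \<mu> v x) = (\<mu>\<^sup>2 - ln v) / 2 + \<mu> * (x - \<mu>) + (1 / 2 - 1 / (2 * v)) * (x - \<mu>)\<^sup>2"
proof -
  have "ln (normal_density \<mu> (sqrt v) x) = - ln (sqrt (2 * pi * v)) - (x - \<mu>)\<^sup>2 / (2 * v)"
    using v by (simp add: normal_density_def ln_mult ln_div)
  moreover have "ln (std_normal_density x) = - ln (sqrt (2 * pi)) - x\<^sup>2 / 2"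
    by (simp add: normal_density_def ln_mult ln_div)
  moreover have "ln (normal_ratio \<mu> v x) = ln (normal_density \<mu> (sqrt v) x) - ln (std_normal_density x)"
    using v normal_density_pos[of "sqrt v" \<mu> x] normal_density_pos[of 1 0 x] by (simp add: ln_div)
  moreover have "ln (sqrt (2 * pi * v)) = ln (sqrt (2 * pi)) + ln v / 2"
    using v by (simp add: ln_sqrt ln_mult)
  ultimately have "ln (normal_ratio \<mu> v x) = x\<^sup>2 / 2 - ln v / 2 - (x - \<mu>)\<^sup>2 / (2 * v)"
    by linarith
  moreover have "(1 / 2 - 1 / (2 * v)) * (x - \<mu>)\<^sup>2 = (x - \<mu>)\<^sup>2 / 2 - (x - \<mu>)\<^sup>2 / (2 * v)"
    by (simp add: left_diff_distrib)
  moreover have "x\<^sup>2 / 2 = \<mu>\<^sup>2 / 2 + \<mu> * (x - \<mu>) + (x - \<mu>)\<^sup>2 / 2"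
    by (simp add: power2_eq_square field_simps)
  ultimately show ?thesis by (simp add: diff_divide_distrib)
qed

text \<open>The integral is the Kullback-Leibler divergence of a normal law with mean
  \<open>\<mu>\<close> and variance \<open>v\<close> from the standard normal law.\<close>

lemma normal_ln_ratio:
  fixes \<mu> :: real
  defines "N \<equiv> density lborel (normal_density \<mu> (sqrt v))"
  shows "integrable N (\<lambda>x. ln (normal_ratio \<mu> v x))"
    "(\<integral>x. ln (normal_ratio \<mu> v x) \<partial>N) = (v + \<mu>\<^sup>2 - 1 - ln v) / 2"
proof -
  interpret prob_space N
    unfolding N_def using v by (intro prob_space_normal_density) simp
  note mom = normal_centered_moments[of \<mu>, folded N_def]
  show "integrable N (\<lambda>x. ln (normal_ratio \<mu> v x))"
    unfolding ln_normal_ratio using mom by simp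
  have "(\<integral>x. ln (normal_ratio \<mu> v x) \<partial>N)
      = (\<mu>\<^sup>2 - ln v) / 2 + \<mu> * 0 + (1 / 2 - 1 / (2 * v)) * v"
    unfolding ln_normal_ratio using mom by (simp add: prob_space)
  then show "(\<integral>x. ln (normal_ratio \<mu> v x) \<partial>N) = (v + \<mu>\<^sup>2 - 1 - ln v) / 2"
    using v by (simp add: left_diff_distrib diff_divide_distrib add_divide_distrib)
qed

text \<open>The logarithm turns the product density into a sum: \<open>K * ln 2\<close> pays for the
  dimension, and each coordinate contributes one normal divergence.\<close>

lemma gauss_law_ln_density:
  assumes K: "1 \<le> K"
  shows "integrable (gauss_law K m v) (\<lambda>f. ln (gauss_prior_density K m v f))"
    "(\<integral>f. ln (gauss_prior_density K m v f) \<partial>gauss_law K m v)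
      = real K * ln 2 + (\<Sum>k=1..K. (v + (m k)\<^sup>2 - 1 - ln v) / 2)"
proof -
  interpret prob_space "coef_law K m v" by (rule prob_space_coef_law[OF v])
  let ?L = "\<lambda>b. real K * ln 2 + (\<Sum>k=1..K. ln (normal_ratio (m k) v (b k)))"
  note measurable_trig_sum_coef_law [measurable]
  have ln_meas: "(\<lambda>f. ln (gauss_prior_density K m v f)) \<in> borel_measurable fun_space"
    by measurable
  have ae: "AE b in coef_law K m v. ln (gauss_prior_density K m v (trig_sum K b)) = ?L b"
    using AE_coef_law_exact_dim[OF v K, of m]
  proof eventually_elim
    case (elim b)
    define q where "q k = normal_ratio (m k) v (b k)" for k
    have q: "0 < q k" for k
      unfolding q_def using v by (intro divide_pos_pos normal_density_pos) auto
    have "ln (2 ^ K * (\<Prod>k=1..K. q k)) = ln (2 ^ K) + ln (\<Prod>k=1..K. q k)"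
      by (intro ln_mult_pos prod_pos) (auto simp: q)
    also have "ln (\<Prod>k=1..K. q k) = (\<Sum>k=1..K. ln (q k))"
      using q by (intro ln_prod) (auto simp: less_imp_neq[THEN not_sym])
    finally show ?case
      unfolding gauss_prior_density_trig_sum[OF elim] q_def by (simp add: ln_realpow)
  qed
  have terms: "integrable (coef_law K m v) (\<lambda>b. ln (normal_ratio (m k) v (b k)))"
    "(\<integral>b. ln (normal_ratio (m k) v (b k)) \<partial>coef_law K m v) = (v + (m k)\<^sup>2 - 1 - ln v) / 2"
    if "k \<in> {1..K}" for k
    using coef_law_coordinate[where k = k, OF that normal_ln_ratio(1)] normal_ln_ratio(2)[of "m k"]
    by simp_all
  have intL: "integrable (coef_law K m v) ?L"
    using terms(1) by (intro Bochner_Integration.integrable_add Bochner_Integration.integrable_sum) auto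
  have meas: "(\<lambda>b. ln (gauss_prior_density K m v (trig_sum K b))) \<in> borel_measurable (coef_law K m v)"
    by measurable
  show "integrable (gauss_law K m v) (\<lambda>f. ln (gauss_prior_density K m v f))"
    unfolding gauss_law_eq_distr integrable_distr_eq[OF measurable_trig_sum_coef_law ln_meas]
    using integrable_cong_AE[OF meas borel_measurable_integrable[OF intL] ae] intL by simp
  have "(\<integral>f. ln (gauss_prior_density K m v f) \<partial>gauss_law K m v) = (\<integral>b. ?L b \<partial>coef_law K m v)"
    unfolding gauss_law_eq_distr integral_distr[OF measurable_trig_sum_coef_law ln_meas]
    by (rule integral_cong_AE[OF meas borel_measurable_integrable[OF intL] ae])
  also have "\<dots> = real K * ln 2 + (\<Sum>k=1..K. \<integral>b. ln (normal_ratio (m k) v (b k)) \<partial>coef_law K m v)"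
    using terms(1) by (subst Bochner_Integration.integral_add)
      (auto simp: prob_space Bochner_Integration.integral_sum intro!: Bochner_Integration.integrable_sum)
  also have "(\<Sum>k=1..K. \<integral>b. ln (normal_ratio (m k) v (b k)) \<partial>coef_law K m v)
      = (\<Sum>k=1..K. (v + (m k)\<^sup>2 - 1 - ln v) / 2)"
    by (intro sum.cong refl terms(2))
  finally show "(\<integral>f. ln (gauss_prior_density K m v f) \<partial>gauss_law K m v)
      = real K * ln 2 + (\<Sum>k=1..K. (v + (m k)\<^sup>2 - 1 - ln v) / 2)" .
qed

text \<open>The library integrates \<open>d * log d\<close> against the prior; the factor
  \<open>d\<close> is absorbed by passing to the Gaussian law.\<close>

lemma KL_gauss_law:
  assumes K: "1 \<le> K"
  shows "KL_divergence (exp 1) prior (gauss_law K m v)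
    = (\<integral>f. ln (gauss_prior_density K m v f) \<partial>gauss_law K m v)"
proof -
  interpret prob_space prior by (rule prob_space_prior)
  have meas: "gauss_prior_density K m v \<in> borel_measurable prior"
    by (simp add: measurable_cong_sets[OF sets_prior refl] measurable_gauss_prior_density)
  have "KL_divergence (exp 1) prior (gauss_law K m v)
      = (\<integral>f. gauss_prior_density K m v f * log (exp 1) (gauss_prior_density K m v f) \<partial>prior)"
    unfolding gauss_law_eq_density[OF v K]
    by (rule KL_density) (auto simp: meas gauss_prior_density_nonneg)
  also have "\<dots> = (\<integral>f. ln (gauss_prior_density K m v f) \<partial>gauss_law K m v)"
    unfolding gauss_law_eq_density[OF v K] log_def
    using meas by (subst integral_density) (auto simp: gauss_prior_density_nonneg)
  finally show ?thesis .
qed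

text \<open>Expansion around the centre \<open>trig_sum K m\<close>: the linear term has mean zero,
  and Cauchy-Schwarz bounds the quadratic one. Only the marginals of the coefficients enter, at the
  price of \<open>K^2 * v\<close> where independence would give \<open>K * v\<close>.\<close>

lemma gauss_law_square_loss:
  assumes w: "w \<in> {-1..1}"
  shows "integrable (gauss_law K m v) (\<lambda>f. (y - f w)\<^sup>2)"
    "(\<integral>f. (y - f w)\<^sup>2 \<partial>gauss_law K m v) \<le> (y - trig_sum K m w)\<^sup>2 + (real K)\<^sup>2 * v"
proof -
  interpret prob_space "coef_law K m v" by (rule prob_space_coef_law[OF v])
  define e where "e = y - trig_sum K m w"
  define u where "u k b = (b k - m k) * trig k w" for k and b :: "nat \<Rightarrow> real"
  define S where "S b = (\<Sum>k=1..K. u k b)" for b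
  have meas: "(\<lambda>f. (y - f w)\<^sup>2) \<in> borel_measurable fun_space"
    using measurable_eval_point[OF w] by measurable
  have split: "(y - trig_sum K b w)\<^sup>2 = e\<^sup>2 - 2 * e * S b + (S b)\<^sup>2" for b
  proof -
    have "trig_sum K b w = trig_sum K m w + S b"
      using w by (simp add: trig_sum_def S_def u_def left_diff_distrib sum_subtractf)
    then show ?thesis
      by (simp add: e_def power2_eq_square algebra_simps)
  qed
  have lin: "integrable (coef_law K m v) (u k)" "(\<integral>b. u k b \<partial>coef_law K m v) = 0"
    if "k \<in> {1..K}" for k
    using coef_law_coordinate[where k = k, OF that normal_centered_moments(1)]
      normal_centered_moments(2)[of "m k"]
    unfolding u_def by simp_all
  have quad: "integrable (coef_law K m v) (\<lambda>b. (u k b)\<^sup>2)" "(\<integral>b. (u k b)\<^sup>2 \<partial>coef_law K m v) \<le> v"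
    if "k \<in> {1..K}" for k
  proof -
    note c = coef_law_coordinate[where k = k, OF that normal_centered_moments(3)]
    show "integrable (coef_law K m v) (\<lambda>b. (u k b)\<^sup>2)"
      unfolding u_def power_mult_distrib using c by simp
    have "(\<integral>b. (u k b)\<^sup>2 \<partial>coef_law K m v) = v * (trig k w)\<^sup>2"
      unfolding u_def power_mult_distrib using c normal_centered_moments(4)[of "m k"] by simp
    also have "\<dots> \<le> v * 1"
      using v abs_trig_le_1[of k w] by (intro mult_left_mono) (auto simp: abs_square_le_1)
    finally show "(\<integral>b. (u k b)\<^sup>2 \<partial>coef_law K m v) \<le> v" by simp
  qed
  have S: "integrable (coef_law K m v) S" "(\<integral>b. S b \<partial>coef_law K m v) = 0"
    unfolding S_def[abs_def] using lin by (auto simp: Bochner_Integration.integral_sum)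
  \<comment> \<open>Cauchy-Schwarz over the \<open>K\<close> summands; this is the source of the
    extra factor \<open>K\<close>.\<close>
  have bound: "(S b)\<^sup>2 \<le> real K * (\<Sum>k=1..K. (u k b)\<^sup>2)" for b
    using sum_squared_le_sum_of_squares[of "\<lambda>k. u k b" "{1..K}"] by (simp add: S_def mult.commute)
  have int_sum: "integrable (coef_law K m v) (\<lambda>b. real K * (\<Sum>k=1..K. (u k b)\<^sup>2))"
    using quad by (intro integrable_mult_right Bochner_Integration.integrable_sum) auto
  have S2: "integrable (coef_law K m v) (\<lambda>b. (S b)\<^sup>2)"
  proof (rule Bochner_Integration.integrable_bound[OF int_sum])
    show "(\<lambda>b. (S b)\<^sup>2) \<in> borel_measurable (coef_law K m v)"
      using borel_measurable_integrable[OF S(1)] by measurable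
    show "AE b in coef_law K m v. norm ((S b)\<^sup>2) \<le> norm (real K * (\<Sum>k=1..K. (u k b)\<^sup>2))"
      using bound by (auto intro!: AE_I2 order_trans[OF _ abs_ge_self])
  qed
  have "(\<integral>b. (S b)\<^sup>2 \<partial>coef_law K m v) \<le> (\<integral>b. real K * (\<Sum>k=1..K. (u k b)\<^sup>2) \<partial>coef_law K m v)"
    by (rule integral_mono[OF S2 int_sum bound])
  also have "\<dots> = real K * (\<Sum>k=1..K. (\<integral>b. (u k b)\<^sup>2 \<partial>coef_law K m v))"
    using quad by (simp add: Bochner_Integration.integral_sum)
  also have "\<dots> \<le> real K * (\<Sum>k=1..K. v)"
    using quad by (intro mult_left_mono sum_mono) auto
  finally have "(\<integral>b. (S b)\<^sup>2 \<partial>coef_law K m v) \<le> (real K)\<^sup>2 * v"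
    by (simp add: power2_eq_square)
  moreover have "(\<integral>f. (y - f w)\<^sup>2 \<partial>gauss_law K m v) = e\<^sup>2 + (\<integral>b. (S b)\<^sup>2 \<partial>coef_law K m v)"
    unfolding gauss_law_eq_distr integral_distr[OF measurable_trig_sum_coef_law meas] split
    using S S2 by (simp add: prob_space)
  ultimately show "(\<integral>f. (y - f w)\<^sup>2 \<partial>gauss_law K m v) \<le> (y - trig_sum K m w)\<^sup>2 + (real K)\<^sup>2 * v"
    by (simp add: e_def)
  show "integrable (gauss_law K m v) (\<lambda>f. (y - f w)\<^sup>2)"
    unfolding gauss_law_eq_distr integrable_distr_eq[OF measurable_trig_sum_coef_law meas] split
    using S S2 by simp
qed

end

section \<open>The change of measure inequality\<close>

text \<open>A Donsker-Varadhan type bound in which \<open>ln z\<close> is weakened to \<open>z - 1\<close>: integrate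
  \<open>ln t \<le> t - 1\<close> at \<open>t = exp (D - a) / d\<close>. The bound is affine in \<open>z\<close>, so taking expectations
  later on needs no Jensen inequality.\<close>

lemma change_of_measure:
  fixes D a d :: "'a \<Rightarrow> real" and M :: "'a measure"
  defines "N \<equiv> density M d"
  assumes d: "d \<in> borel_measurable M" "\<And>x. 0 \<le> d x" and N: "prob_space N"
    and ln_d: "integrable N (\<lambda>x. ln (d x))" and a: "integrable N a"
    and D: "D \<in> borel_measurable M" "\<And>x. 0 \<le> D x"
    and z: "0 \<le> z" "(\<integral>\<^sup>+x. ennreal (exp (D x - a x)) \<partial>M) \<le> ennreal z"
  shows "(\<integral>\<^sup>+x. ennreal (D x) \<partial>N) \<le> ennreal ((\<integral>x. a x \<partial>N) + (\<integral>x. ln (d x) \<partial>N) + z - 1)"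
    and "0 \<le> (\<integral>x. a x \<partial>N) + (\<integral>x. ln (d x) \<partial>N) + z - 1"
proof -
  interpret prob_space N by (rule N)
  define w where "w x = exp (D x - a x) / d x" for x
  define Q where "Q x = a x + ln (d x) + w x - 1" for x
  have sets: "measurable N borel = (measurable M borel :: ('a \<Rightarrow> real) set)"
    unfolding N_def by (rule measurable_cong_sets) simp_all
  have aM: "a \<in> borel_measurable M"
    using borel_measurable_integrable[OF a] sets by simp
  have wM [measurable]: "w \<in> borel_measurable M"
    unfolding w_def[abs_def] using d D aM by measurable
  have w0: "0 \<le> w x" for x by (simp add: w_def d)
  have "(\<integral>\<^sup>+x. ennreal (w x) \<partial>N) = (\<integral>\<^sup>+x. ennreal (d x) * ennreal (w x) \<partial>M)"
    unfolding N_def using d by (intro nn_integral_density) auto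
  \<comment> \<open>An inequality, since division by zero makes \<open>w x\<close> equal to 0
    wherever \<open>d x\<close> is 0.\<close>
  also have "\<dots> \<le> (\<integral>\<^sup>+x. ennreal (exp (D x - a x)) \<partial>M)"
    using d by (intro nn_integral_mono) (auto simp: w_def simp flip: ennreal_mult intro!: ennreal_leI)
  finally have wz: "(\<integral>\<^sup>+x. ennreal (w x) \<partial>N) \<le> ennreal z" using z by simp
  have int_w: "integrable N w"
  proof (rule integrableI_nonneg)
    show "w \<in> borel_measurable N" using wM sets by simp
    show "AE x in N. 0 \<le> w x" by (simp add: w0)
    show "(\<integral>\<^sup>+x. ennreal (w x) \<partial>N) < \<infinity>" using wz by (auto intro: le_less_trans)
  qed
  have "ennreal (\<integral>x. w x \<partial>N) \<le> ennreal z"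
    using wz nn_integral_eq_integral[OF int_w] w0 by simp
  then have w_le: "(\<integral>x. w x \<partial>N) \<le> z" using z by simp
  have int_Q: "integrable N Q"
    unfolding Q_def[abs_def] using a ln_d int_w by simp
  have Q: "(\<integral>x. Q x \<partial>N) \<le> (\<integral>x. a x \<partial>N) + (\<integral>x. ln (d x) \<partial>N) + z - 1"
    unfolding Q_def using a ln_d int_w w_le by (simp add: prob_space)
  have "AE x in N. 0 < d x"
    unfolding N_def using d by (subst AE_density) auto
  then have DQ: "AE x in N. D x \<le> Q x"
  proof eventually_elim
    case (elim x)
    have "ln (w x) \<le> w x - 1"
      using elim by (intro ln_le_minus_one) (simp add: w_def)
    moreover have "ln (w x) = D x - a x - ln (d x)"
      using elim by (simp add: w_def ln_div)
    ultimately show ?case by (simp add: Q_def)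
  qed
  \<comment> \<open>Nonnegativity of \<open>D\<close> passes to \<open>Q\<close>, which allows its
    Bochner integral to be read as a nonnegative integral.\<close>
  then have Q0: "AE x in N. 0 \<le> Q x"
    by eventually_elim (use D in \<open>auto intro: order_trans\<close>)
  have "0 \<le> (\<integral>x. Q x \<partial>N)" by (rule integral_nonneg_AE[OF Q0])
  with Q show "0 \<le> (\<integral>x. a x \<partial>N) + (\<integral>x. ln (d x) \<partial>N) + z - 1" by simp
  have "(\<integral>\<^sup>+x. ennreal (D x) \<partial>N) \<le> (\<integral>\<^sup>+x. ennreal (Q x) \<partial>N)"
    using DQ by (intro nn_integral_mono_AE) (auto intro: ennreal_leI elim: eventually_mono)
  also have "\<dots> = ennreal (\<integral>x. Q x \<partial>N)"
    by (rule nn_integral_eq_integral[OF int_Q Q0])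
  finally show "(\<integral>\<^sup>+x. ennreal (D x) \<partial>N) \<le> ennreal ((\<integral>x. a x \<partial>N) + (\<integral>x. ln (d x) \<partial>N) + z - 1)"
    using Q by (meson ennreal_leI order_trans)
qed

section \<open>Likelihood ratios and the Renyi divergence\<close>

lemma sets_obs_law [simp]: "sets (obs_law f) = sets (leb \<Otimes>\<^sub>M lborel)"
  by (simp add: obs_law_def)

lemma fun_space_measurable_leb: "f \<in> space fun_space \<Longrightarrow> f \<in> borel_measurable leb"
  by (auto simp: space_fun_space intro: continuous_imp_measurable_leb)

lemma measurable_obs_map:
  assumes [measurable]: "f \<in> borel_measurable leb"
  shows "(\<lambda>(w, \<xi>). (w, f w + \<xi>))
    \<in> uniform_measure leb {-1..1} \<Otimes>\<^sub>M density lborel std_normal_density \<rightarrow>\<^sub>M leb \<Otimes>\<^sub>M lborel"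
  by measurable

lemma prob_space_uniform_leb: "prob_space (uniform_measure leb {-1..1})"
  by (rule prob_space_uniform_measure) (simp_all add: emeasure_leb_space)

lemma pair_prob_space_obs:
  "pair_prob_space (uniform_measure leb {-1..1}) (density lborel std_normal_density)"
proof -
  interpret U: prob_space "uniform_measure leb {-1..1}" by (rule prob_space_uniform_leb)
  interpret N: prob_space "density lborel std_normal_density"
    by (rule prob_space_normal_density) simp
  show ?thesis ..
qed

lemma prob_space_obs_law:
  assumes "f \<in> borel_measurable leb"
  shows "prob_space (obs_law f)"
proof -
  interpret P: pair_prob_space "uniform_measure leb {-1..1}" "density lborel std_normal_density"
    by (rule pair_prob_space_obs)
  show ?thesis
    unfolding obs_law_def by (rule P.prob_space_distr[OF measurable_obs_map[OF assms]])
qed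

text \<open>The log-likelihood ratio of a single observation: the normalising constants of the two
  densities cancel.\<close>

definition excess_loss :: "(real \<Rightarrow> real) \<Rightarrow> (real \<Rightarrow> real) \<Rightarrow> real \<times> real \<Rightarrow> real" where
  "excess_loss f f0 p = ((snd p - f (fst p))\<^sup>2 - (snd p - f0 (fst p))\<^sup>2) / 2"

lemma log_lik_ratio_eq: "log_lik_ratio n X f f0 = (\<Sum>i=1..n. excess_loss f f0 (X i))"
  unfolding log_lik_ratio_def
proof (rule sum.cong)
  fix i
  show "ln (obs_density f0 (X i) / obs_density f (X i)) = excess_loss f f0 (X i)"
    by (cases "X i") (simp add: obs_density_def normal_density_def excess_loss_def ln_div ln_mult field_simps)
qed simp

text \<open>Function and observation both vary with \<open>x\<close>, as exchanging the prior and
  sample integrals requires.\<close>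

lemma measurable_excess_loss:
  assumes g: "g \<in> measurable M fun_space" and h: "h \<in> measurable M (leb \<Otimes>\<^sub>M lborel)"
    and f0: "f0 \<in> borel_measurable leb"
  shows "(\<lambda>x. excess_loss (g x) f0 (h x)) \<in> borel_measurable M"
proof -
  have 1: "(\<lambda>x. fst (h x)) \<in> measurable M leb"
    by (rule measurable_compose[OF h measurable_fst])
  have "snd \<in> borel_measurable (leb \<Otimes>\<^sub>M lborel)" by measurable
  from measurable_compose[OF h this] have [measurable]: "(\<lambda>x. snd (h x)) \<in> borel_measurable M" .
  note [measurable] = measurable_eval[OF g 1] measurable_compose[OF 1 f0]
  show ?thesis unfolding excess_loss_def by measurable
qed

text \<open>Completing the square in \<open>y\<close> turns the tilted density into a normal density
  centred at \<open>\<alpha> * f w + (1 - \<alpha>) * f0 w\<close>, times a factor depending on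
  \<open>w\<close> only; the normal density integrates to 1.\<close>

lemma nn_integral_exp_excess_loss:
  assumes f: "f \<in> borel_measurable leb" and f0: "f0 \<in> borel_measurable leb"
  shows "(\<integral>\<^sup>+p. ennreal (exp (- \<alpha> * excess_loss f f0 p)) \<partial>obs_law f0)
    = (\<integral>\<^sup>+w. ennreal (1 / 2 * exp (\<alpha> * (\<alpha> - 1) * (f w - f0 w)\<^sup>2 / 2)) \<partial>leb)"
proof -
  note [measurable] = f f0
  let ?e = "\<lambda>w. exp (\<alpha> * (\<alpha> - 1) * (f w - f0 w)\<^sup>2 / 2)"
  let ?c = "\<lambda>w. \<alpha> * f w + (1 - \<alpha>) * f0 w"
  have dens: "(\<lambda>p. ennreal (obs_density f0 p)) \<in> borel_measurable (leb \<Otimes>\<^sub>M lborel)"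
    unfolding obs_density_def normal_density_def by measurable
  have loss: "(\<lambda>p. excess_loss f f0 p) \<in> borel_measurable (leb \<Otimes>\<^sub>M lborel)"
    unfolding excess_loss_def by measurable
  have pw: "obs_density f0 (w, y) * exp (- \<alpha> * excess_loss f f0 (w, y))
      = 1 / 2 * ?e w * normal_density (?c w) 1 y" for w y
  proof -
    have "- (y - f0 w)\<^sup>2 / 2 + - \<alpha> * (((y - f w)\<^sup>2 - (y - f0 w)\<^sup>2) / 2)
        = \<alpha> * (\<alpha> - 1) * (f w - f0 w)\<^sup>2 / 2 + - (y - ?c w)\<^sup>2 / 2"
      by (simp add: power2_eq_square field_simps)
    then have "exp (- (y - f0 w)\<^sup>2 / 2) * exp (- \<alpha> * (((y - f w)\<^sup>2 - (y - f0 w)\<^sup>2) / 2))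
        = ?e w * exp (- (y - ?c w)\<^sup>2 / 2)"
      by (simp only: mult_exp_exp)
    then show ?thesis
      by (simp add: obs_density_def normal_density_def excess_loss_def)
  qed
  have mass: "(\<integral>\<^sup>+y. ennreal (normal_density c 1 y) \<partial>lborel) = 1" for c
    using prob_space.emeasure_space_1[OF prob_space_normal_density[of 1 c]]
    by (simp add: emeasure_density)
  have "(\<integral>\<^sup>+p. ennreal (exp (- \<alpha> * excess_loss f f0 p)) \<partial>obs_law f0)
      = (\<integral>\<^sup>+p. ennreal (obs_density f0 p * exp (- \<alpha> * excess_loss f f0 p)) \<partial>(leb \<Otimes>\<^sub>M lborel))"
    unfolding obs_law_eq_density[OF f0] using dens loss
    by (subst nn_integral_density) (auto simp: ennreal_mult'')
  also have "\<dots> = (\<integral>\<^sup>+w. \<integral>\<^sup>+y. ennreal (obs_density f0 (w, y) * exp (- \<alpha> * excess_loss f f0 (w, y))) \<partial>lborel \<partial>leb)"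
    using dens loss unfolding obs_density_def normal_density_def
    by (subst lborel.nn_integral_fst[symmetric]) auto
  also have "\<dots> = (\<integral>\<^sup>+w. ennreal (1 / 2 * ?e w) \<partial>leb)"
    unfolding pw
    by (subst ennreal_mult') (simp_all add: nn_integral_cmult mass del: times_divide_eq_left)
  finally show ?thesis .
qed

section \<open>The Renyi divergence as the logarithm of an affinity\<close>

context
  fixes \<alpha> :: real and f f0 :: "real \<Rightarrow> real"
  assumes \<alpha>: "0 < \<alpha>" "\<alpha> < 1"
    and f: "f \<in> borel_measurable leb" and f0: "f0 \<in> borel_measurable leb"
begin

private abbreviation (input) "e \<equiv> \<lambda>x. exp (\<alpha> * (\<alpha> - 1) * (f x - f0 x)\<^sup>2 / 2)"

text \<open>The exponent is nonpositive for \<open>\<alpha>\<close> in (0,1), so the integrand lies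
  in (0,1] on a space of mass 2. Strict positivity keeps the logarithm in \<open>renyi\<close> away
  from 0.\<close>

lemma renyi_integrand:
  shows "integrable leb (\<lambda>x. exp (\<alpha> * (\<alpha> - 1) * (f x - f0 x)\<^sup>2 / 2))"
    and "0 < (\<integral>x. exp (\<alpha> * (\<alpha> - 1) * (f x - f0 x)\<^sup>2 / 2) \<partial>leb)"
    and "(\<integral>x. exp (\<alpha> * (\<alpha> - 1) * (f x - f0 x)\<^sup>2 / 2) \<partial>leb) \<le> 2"
proof -
  interpret finite_measure leb by (rule finite_measure_leb)
  note [measurable] = f f0
  have le1: "e x \<le> 1" for x
    using \<alpha> by (simp add: mult_nonneg_nonpos mult_nonpos_nonneg)
  show int: "integrable leb e"
    by (rule integrable_const_bound[where B = 1]) (use le1 in \<open>auto intro!: AE_I2\<close>)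
  have meas2: "measure leb {-1..1} = 2"
    by (simp add: measure_def emeasure_leb_space)
  have "integral\<^sup>L leb e \<le> (\<integral>x. 1 \<partial>leb)"
    by (rule integral_mono[OF int]) (use le1 in auto)
  then show "integral\<^sup>L leb e \<le> 2" using meas2 by simp
  have "integral\<^sup>L leb e \<noteq> 0"
  proof
    assume "integral\<^sup>L leb e = 0"
    then have "AE x in leb. e x = 0"
      using integral_nonneg_eq_0_iff_AE[OF int] by simp
    then have "AE x in leb. False" by simp
    then have "emeasure leb (space leb) = 0" using AE_E2[where M = leb and P = "\<lambda>_. False"] by (simp del: space_leb)
    then show False using emeasure_leb_space by simp
  qed
  moreover have "0 \<le> integral\<^sup>L leb e" by (rule Bochner_Integration.integral_nonneg) simp
  ultimately show "0 < integral\<^sup>L leb e" by linarith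
qed

lemma renyi_nonneg: "0 \<le> renyi \<alpha> f f0"
proof -
  have "ln (1 / 2 * integral\<^sup>L leb e) \<le> 0"
    using renyi_integrand(2,3) by simp
  then show ?thesis
    unfolding renyi_def using \<alpha> by (intro mult_nonpos_nonpos) auto
qed

text \<open>Exponentiating undoes the logarithm and the prefactor \<open>1 / (\<alpha> - 1)\<close>
  in \<open>renyi\<close>. This identity is what normalises the partition function.\<close>

lemma nn_integral_exp_excess_loss_eq_renyi:
  "(\<integral>\<^sup>+p. ennreal (exp (- \<alpha> * excess_loss f f0 p)) \<partial>obs_law f0)
    = ennreal (exp (- (1 - \<alpha>) * renyi \<alpha> f f0))"
proof -
  have "- (1 - \<alpha>) * (1 / (\<alpha> - 1) * l) = l" for l
    using \<alpha> by (simp add: field_simps)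
  then have "exp (- (1 - \<alpha>) * renyi \<alpha> f f0) = 1 / 2 * integral\<^sup>L leb e"
    unfolding renyi_def using renyi_integrand(2) by simp
  also have "ennreal \<dots> = ennreal (\<integral>x. 1 / 2 * e x \<partial>leb)" by simp
  also have "\<dots> = (\<integral>\<^sup>+w. ennreal (1 / 2 * e w) \<partial>leb)"
    using renyi_integrand(1) by (intro nn_integral_eq_integral[symmetric]) auto
  finally show ?thesis
    unfolding nn_integral_exp_excess_loss[OF f f0] ..
qed

end

section \<open>Integration over the sample\<close>

lemma prob_space_sample_law:
  "f0 \<in> borel_measurable leb \<Longrightarrow> prob_space (sample_law f0 n)"
  unfolding sample_law_def by (intro prob_space_PiM prob_space_obs_law)

lemma measurable_sample_component:
  "i \<in> {1..n} \<Longrightarrow> (\<lambda>X. X i) \<in> measurable (sample_law f0 n) (leb \<Otimes>\<^sub>M lborel)"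
  unfolding sample_law_def
  using measurable_component_singleton[of i "{1..n}" "\<lambda>_. obs_law f0"]
  by (simp add: measurable_cong_sets[OF refl sets_obs_law])

lemma sample_component_space:
  "X \<in> space (sample_law f0 n) \<Longrightarrow> i \<in> {1..n} \<Longrightarrow> fst (X i) \<in> {-1..1}"
  using measurable_space[OF measurable_sample_component] by (fastforce simp: space_pair_measure)

lemma sample_law_component:
  fixes U :: "real \<times> real \<Rightarrow> real"
  assumes f0: "f0 \<in> borel_measurable leb" and i: "i \<in> {1..n}" and U: "integrable (obs_law f0) U"
  shows "integrable (sample_law f0 n) (\<lambda>X. U (X i))"
    "(\<integral>X. U (X i) \<partial>sample_law f0 n) = integral\<^sup>L (obs_law f0) U"
proof -
  have eq: "distr (sample_law f0 n) (obs_law f0) (\<lambda>X. X i) = obs_law f0"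
    unfolding sample_law_def by (intro distr_PiM_component prob_space_obs_law f0 i)
  have meas: "(\<lambda>X. X i) \<in> measurable (sample_law f0 n) (obs_law f0)"
    unfolding sample_law_def using i by measurable
  show "integrable (sample_law f0 n) (\<lambda>X. U (X i))"
    using integrable_distr_eq[OF meas borel_measurable_integrable[OF U]] U eq by simp
  show "(\<integral>X. U (X i) \<partial>sample_law f0 n) = integral\<^sup>L (obs_law f0) U"
    using integral_distr[OF meas borel_measurable_integrable[OF U]] eq by simp
qed

text \<open>The quantity \<open>Z\<close>, kept in \<open>ennreal\<close> because its finiteness is
  only established almost surely.\<close>

definition partition_fun :: "real \<Rightarrow> (real \<Rightarrow> real) \<Rightarrow> nat \<Rightarrow> (nat \<Rightarrow> real \<times> real) \<Rightarrow> ennreal" where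
  "partition_fun \<alpha> f0 n X =
    (\<integral>\<^sup>+f. ennreal (exp (real n * (1 - \<alpha>) * renyi \<alpha> f f0 - \<alpha> * log_lik_ratio n X f f0)) \<partial>prior)"

text \<open>Tonelli moves the sample integral inside. For a fixed continuous \<open>f\<close> it
  factorises over the observations, and each factor is
  \<open>exp ((1 - \<alpha>) * D) * exp (- (1 - \<alpha>) * D) = 1\<close>.\<close>

lemma
  assumes \<alpha>: "0 < \<alpha>" "\<alpha> < 1" and f0: "f0 \<in> borel_measurable leb"
  shows measurable_partition_fun: "partition_fun \<alpha> f0 n \<in> borel_measurable (sample_law f0 n)"
    and nn_integral_partition_fun: "(\<integral>\<^sup>+X. partition_fun \<alpha> f0 n X \<partial>sample_law f0 n) = 1"
proof -
  interpret P: prob_space prior by (rule prob_space_prior)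
  interpret S: prob_space "sample_law f0 n" by (rule prob_space_sample_law[OF f0])
  interpret PS: pair_sigma_finite "sample_law f0 n" prior ..
  interpret O: product_sigma_finite "\<lambda>_::nat. obs_law f0"
    unfolding product_sigma_finite_def
    using prob_space_imp_sigma_finite[OF prob_space_obs_law[OF f0]] by blast
  let ?F = "\<lambda>X f. ennreal (exp (real n * (1 - \<alpha>) * renyi \<alpha> f f0 - \<alpha> * log_lik_ratio n X f f0))"
  have snd: "snd \<in> measurable (sample_law f0 n \<Otimes>\<^sub>M prior) fun_space"
    using measurable_snd[of "sample_law f0 n" prior] by (simp only: measurable_cong_sets[OF refl sets_prior])
  have loss: "(\<lambda>p. excess_loss (snd p) f0 (fst p i)) \<in> borel_measurable (sample_law f0 n \<Otimes>\<^sub>M prior)"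
    if "i \<in> {1..n}" for i
    by (rule measurable_excess_loss[OF snd measurable_compose[OF measurable_fst measurable_sample_component[OF that]] f0])
  have "(\<lambda>p. log_lik_ratio n (fst p) (snd p) f0) \<in> borel_measurable (sample_law f0 n \<Otimes>\<^sub>M prior)"
    unfolding log_lik_ratio_eq by (rule borel_measurable_sum) (rule loss)
  note [measurable] = this measurable_compose[OF snd measurable_renyi[OF f0]]
  have F: "(\<lambda>(X, f). ?F X f) \<in> borel_measurable (sample_law f0 n \<Otimes>\<^sub>M prior)"
    unfolding case_prod_beta by measurable
  show "partition_fun \<alpha> f0 n \<in> borel_measurable (sample_law f0 n)"
    unfolding partition_fun_def[abs_def] by (rule P.borel_measurable_nn_integral[OF F])
  have inner: "(\<integral>\<^sup>+X. ?F X f \<partial>sample_law f0 n) = 1" if "f \<in> space prior" for f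
  proof -
    have f: "f \<in> borel_measurable leb"
      using that by (simp add: fun_space_measurable_leb)
    let ?R = "renyi \<alpha> f f0"
    have loss1: "(\<lambda>p. excess_loss f f0 p) \<in> borel_measurable (obs_law f0)"
      unfolding excess_loss_def using f f0 by (simp add: measurable_cong_sets[OF sets_obs_law refl])
    \<comment> \<open>The term \<open>n * (1 - \<alpha>) * D\<close> is shared equally among the
      \<open>n\<close> observations, which makes the integrand a product.\<close>
    have F_eq: "?F X f = (\<Prod>i=1..n. ennreal (exp ((1 - \<alpha>) * ?R)) * ennreal (exp (- \<alpha> * excess_loss f f0 (X i))))" for X
    proof -
      have "exp (real n * (1 - \<alpha>) * ?R - \<alpha> * log_lik_ratio n X f f0)
          = exp (\<Sum>i=1..n. (1 - \<alpha>) * ?R + - \<alpha> * excess_loss f f0 (X i))"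
        by (simp add: log_lik_ratio_eq sum_subtractf sum_distrib_left)
      also have "\<dots> = (\<Prod>i=1..n. exp ((1 - \<alpha>) * ?R) * exp (- \<alpha> * excess_loss f f0 (X i)))"
        by (subst exp_sum) (simp_all only: exp_add finite_atLeastAtMost)
      finally show ?thesis
        by (simp add: prod_ennreal flip: ennreal_mult)
    qed
    have "(\<integral>\<^sup>+X. ?F X f \<partial>sample_law f0 n)
        = (\<Prod>i=1..n. \<integral>\<^sup>+p. ennreal (exp ((1 - \<alpha>) * ?R)) * ennreal (exp (- \<alpha> * excess_loss f f0 p)) \<partial>obs_law f0)"
      unfolding F_eq sample_law_def using loss1 by (intro O.product_nn_integral_prod) auto
    also have "\<dots> = (\<Prod>i=1..n. ennreal (exp ((1 - \<alpha>) * ?R)) * ennreal (exp (- (1 - \<alpha>) * ?R)))"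
      using loss1 by (subst nn_integral_cmult) (auto simp: nn_integral_exp_excess_loss_eq_renyi[OF \<alpha> f f0, simplified])
    also have "\<dots> = 1"
      by (simp add: algebra_simps flip: ennreal_mult exp_add)
    finally show ?thesis .
  qed
  have "(\<integral>\<^sup>+X. partition_fun \<alpha> f0 n X \<partial>sample_law f0 n)
      = (\<integral>\<^sup>+f. \<integral>\<^sup>+X. ?F X f \<partial>sample_law f0 n \<partial>prior)"
    unfolding partition_fun_def by (rule PS.Fubini'[OF F, symmetric])
  also have "\<dots> = (\<integral>\<^sup>+f. 1 \<partial>prior)"
    by (rule nn_integral_cong) (rule inner)
  finally show "(\<integral>\<^sup>+X. partition_fun \<alpha> f0 n X \<partial>sample_law f0 n) = 1"
    using P.emeasure_space_1 by simp
qed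

section \<open>Expected excess loss of a fixed function\<close>

lemma uniform_leb_eq: "uniform_measure leb {-1..1} = density leb (\<lambda>_. ennreal (1 / 2))"
  unfolding uniform_measure_def emeasure_leb_space
  by (rule density_cong)
    (auto intro!: AE_I2 simp: ennreal_inverse_two divide_ennreal_def simp flip: space_leb)

lemma pair_integral_mult:
  fixes g :: "'a \<Rightarrow> real" and h :: "'b \<Rightarrow> real"
  assumes "pair_sigma_finite M N" and g: "integrable M g" and h: "integrable N h"
  shows "integrable (M \<Otimes>\<^sub>M N) (\<lambda>p. g (fst p) * h (snd p))"
    and "(\<integral>p. g (fst p) * h (snd p) \<partial>(M \<Otimes>\<^sub>M N)) = integral\<^sup>L M g * integral\<^sup>L N h"
proof -
  interpret pair_sigma_finite M N by fact
  note [measurable] = borel_measurable_integrable[OF g] borel_measurable_integrable[OF h]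
  show int: "integrable (M \<Otimes>\<^sub>M N) (\<lambda>p. g (fst p) * h (snd p))"
    using g h by (intro Fubini_integrable) (auto simp: abs_mult)
  show "(\<integral>p. g (fst p) * h (snd p) \<partial>(M \<Otimes>\<^sub>M N)) = integral\<^sup>L M g * integral\<^sup>L N h"
    using integral_fst'[OF int] by simp
qed

text \<open>With \<open>y = f0 w + \<xi>\<close> the loss is half the squared error plus the error
  times \<open>\<xi>\<close>, and the latter has mean zero. The 1/4 is this half times the uniform
  density 1/2.\<close>

lemma obs_law_excess_loss:
  assumes f0: "f0 \<in> borel_measurable leb" and g: "g \<in> borel_measurable leb"
    and sq: "integrable leb (\<lambda>w. (f0 w - g w)\<^sup>2)"
  shows "integrable (obs_law f0) (excess_loss g f0)"
    and "(\<integral>p. excess_loss g f0 p \<partial>obs_law f0) = (\<integral>w. (f0 w - g w)\<^sup>2 \<partial>leb) / 4"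
proof -
  let ?U = "uniform_measure leb {-1..1}" and ?N = "density lborel std_normal_density"
  let ?d = "\<lambda>w. f0 w - g w"
  interpret P: pair_prob_space ?U ?N by (rule pair_prob_space_obs)
  interpret F: finite_measure leb by (rule finite_measure_leb)
  have d: "integrable leb ?d"
    using F.square_integrable_imp_integrable[OF _ sq] f0 g by simp
  have U: "integrable ?U k" "integral\<^sup>L ?U k = integral\<^sup>L leb k / 2" if "integrable leb k" for k :: "real \<Rightarrow> real"
    unfolding uniform_leb_eq
    using that integrable_density[of k leb "\<lambda>_. 1 / 2"] integral_density[of k leb "\<lambda>_. 1 / 2"]
    by simp_all
  have N: "integrable ?N (\<lambda>x. x)" "(\<integral>x. x \<partial>?N) = 0"
    using normal_centered_moments[of 1 0] by simp_all
  note q = pair_integral_mult[OF P.pair_sigma_finite_axioms U(1)[OF sq], of "\<lambda>_. 1"]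
  note l = pair_integral_mult[OF P.pair_sigma_finite_axioms U(1)[OF d] N(1)]
  have meas: "excess_loss g f0 \<in> borel_measurable (leb \<Otimes>\<^sub>M lborel)"
    unfolding excess_loss_def[abs_def] using f0 g by measurable
  have split: "excess_loss g f0 (case p of (w, \<xi>) \<Rightarrow> (w, f0 w + \<xi>))
      = (?d (fst p))\<^sup>2 * 1 / 2 + ?d (fst p) * snd p" for p
    by (simp add: excess_loss_def case_prod_beta power2_eq_square field_simps)
  show "integrable (obs_law f0) (excess_loss g f0)"
    unfolding obs_law_def integrable_distr_eq[OF measurable_obs_map[OF f0] meas] split
    using q l by (intro Bochner_Integration.integrable_add) auto
  have "(\<integral>p. excess_loss g f0 p \<partial>obs_law f0)
      = (\<integral>p. (?d (fst p))\<^sup>2 * 1 / 2 \<partial>(?U \<Otimes>\<^sub>M ?N)) + (\<integral>p. ?d (fst p) * snd p \<partial>(?U \<Otimes>\<^sub>M ?N))"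
    unfolding obs_law_def integral_distr[OF measurable_obs_map[OF f0] meas] split
    using q l by (intro Bochner_Integration.integral_add) auto
  also have "\<dots> = (\<integral>w. (?d w)\<^sup>2 \<partial>leb) / 4"
    using q l N U(2)[OF sq] P.M2.prob_space by simp
  finally show "(\<integral>p. excess_loss g f0 p \<partial>obs_law f0) = (\<integral>w. (f0 w - g w)\<^sup>2 \<partial>leb) / 4" .
qed

section \<open>An oracle inequality\<close>

lemma gauss_law_excess_loss:
  assumes v: "0 < v" and w: "fst p \<in> {-1..1}"
  shows "integrable (gauss_law K m v) (\<lambda>f. excess_loss f f0 p)"
    "(\<integral>f. excess_loss f f0 p \<partial>gauss_law K m v)
      \<le> excess_loss (trig_sum K m) f0 p + (real K)\<^sup>2 * v / 2"
proof -
  interpret prob_space "gauss_law K m v" by (rule prob_space_gauss_law[OF v])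
  note sq = gauss_law_square_loss[OF v w, of K m "snd p"]
  show "integrable (gauss_law K m v) (\<lambda>f. excess_loss f f0 p)"
    unfolding excess_loss_def using sq by simp
  have "(\<integral>f. excess_loss f f0 p \<partial>gauss_law K m v)
      = ((\<integral>f. (snd p - f (fst p))\<^sup>2 \<partial>gauss_law K m v) - (snd p - f0 (fst p))\<^sup>2) / 2"
    unfolding excess_loss_def using sq by (simp add: prob_space)
  then show "(\<integral>f. excess_loss f f0 p \<partial>gauss_law K m v)
      \<le> excess_loss (trig_sum K m) f0 p + (real K)\<^sup>2 * v / 2"
    using sq(2) unfolding excess_loss_def by (simp add: field_simps)
qed

lemma gauss_law_log_lik_ratio:
  assumes v: "0 < v" and X: "X \<in> space (sample_law f0 n)"
  shows "integrable (gauss_law K m v) (\<lambda>f. log_lik_ratio n X f f0)"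
    "(\<integral>f. log_lik_ratio n X f f0 \<partial>gauss_law K m v)
      \<le> (\<Sum>i=1..n. excess_loss (trig_sum K m) f0 (X i) + (real K)\<^sup>2 * v / 2)"
proof -
  note loss = gauss_law_excess_loss[OF v sample_component_space[OF X], of _ K m f0]
  show "integrable (gauss_law K m v) (\<lambda>f. log_lik_ratio n X f f0)"
    unfolding log_lik_ratio_eq using loss(1) by (intro Bochner_Integration.integrable_sum)
  have "(\<integral>f. log_lik_ratio n X f f0 \<partial>gauss_law K m v)
      = (\<Sum>i=1..n. \<integral>f. excess_loss f f0 (X i) \<partial>gauss_law K m v)"
    unfolding log_lik_ratio_eq using loss(1) by (intro Bochner_Integration.integral_sum)
  also have "\<dots> \<le> (\<Sum>i=1..n. excess_loss (trig_sum K m) f0 (X i) + (real K)\<^sup>2 * v / 2)"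
    by (intro sum_mono loss(2))
  finally show "(\<integral>f. log_lik_ratio n X f f0 \<partial>gauss_law K m v)
      \<le> (\<Sum>i=1..n. excess_loss (trig_sum K m) f0 (X i) + (real K)\<^sup>2 * v / 2)" .
qed

text \<open>This is \<open>change_of_measure\<close> for the density relative to the prior. It holds
  separately for each sample \<open>X\<close>, so it may be applied to a law chosen after seeing
  \<open>X\<close>.\<close>

lemma var_family_renyi_bound:
  assumes \<alpha>: "0 < \<alpha>" "\<alpha> < 1" and f0: "f0 \<in> borel_measurable leb"
    and \<rho>: "\<rho> \<in> var_family" and X: "X \<in> space (sample_law f0 n)"
    and fin: "partition_fun \<alpha> f0 n X < \<infinity>"
  defines "B \<equiv> var_objective \<alpha> f0 n X \<rho> + enn2real (partition_fun \<alpha> f0 n X) - 1"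
  shows "ennreal (real n * (1 - \<alpha>)) * (\<integral>\<^sup>+f. ennreal (renyi \<alpha> f f0) \<partial>\<rho>) \<le> ennreal B"
    and "0 \<le> B"
proof -
  obtain K m v where K: "1 \<le> K" and v: "0 < v" and \<rho>_eq: "\<rho> = gauss_law K m v"
    using \<rho> by (auto simp: var_family_def)
  let ?d = "gauss_prior_density K m v" and ?D = "\<lambda>f. real n * (1 - \<alpha>) * renyi \<alpha> f f0"
  let ?a = "\<lambda>f. \<alpha> * log_lik_ratio n X f f0"
  have dens: "gauss_law K m v = density prior ?d" by (rule gauss_law_eq_density[OF v K])
  have renyi: "(\<lambda>f. renyi \<alpha> f f0) \<in> borel_measurable prior"
    using measurable_renyi[OF f0] by (simp only: measurable_cong_sets[OF sets_prior refl])
  have D: "?D \<in> borel_measurable prior" using renyi by measurable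
  have d: "?d \<in> borel_measurable prior"
    by (simp only: measurable_cong_sets[OF sets_prior refl] measurable_gauss_prior_density)
  text \<open>Nonnegativity of the divergence only holds on the space of continuous functions, whence
    the truncation at zero.\<close>
  have D_eq: "max 0 (?D f) = ?D f" if "f \<in> space prior" for f
    using renyi_nonneg[OF \<alpha> fun_space_measurable_leb f0, of f] that \<alpha> by (simp add: max_def)
  have part: "(\<integral>\<^sup>+f. ennreal (exp (max 0 (?D f) - ?a f)) \<partial>prior) = partition_fun \<alpha> f0 n X"
    unfolding partition_fun_def by (intro nn_integral_cong) (simp only: D_eq)
  have B_eq: "B = (\<integral>f. ?a f \<partial>gauss_law K m v) + (\<integral>f. ln (?d f) \<partial>gauss_law K m v)
      + enn2real (partition_fun \<alpha> f0 n X) - 1"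
    unfolding B_def var_objective_def \<rho>_eq KL_gauss_law[OF v K] by simp
  have a: "integrable (gauss_law K m v) ?a"
    using gauss_law_log_lik_ratio(1)[OF v X, of K m] by simp
  have z: "(\<integral>\<^sup>+f. ennreal (exp (max 0 (?D f) - ?a f)) \<partial>prior)
      \<le> ennreal (enn2real (partition_fun \<alpha> f0 n X))"
    using fin by (simp add: part)
  have D': "(\<lambda>f. max 0 (?D f)) \<in> borel_measurable prior" using D by measurable
  note bound = change_of_measure[OF d gauss_prior_density_nonneg, folded dens,
      OF prob_space_gauss_law[OF v] gauss_law_ln_density(1)[OF v K] a D' max.cobounded1 enn2real_nonneg z,
      folded B_eq]
  have "ennreal (real n * (1 - \<alpha>)) * (\<integral>\<^sup>+f. ennreal (renyi \<alpha> f f0) \<partial>\<rho>)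
      = (\<integral>\<^sup>+f. ennreal (real n * (1 - \<alpha>)) * ennreal (renyi \<alpha> f f0) \<partial>\<rho>)"
    using measurable_renyi[OF f0] unfolding \<rho>_eq
    by (intro nn_integral_cmult[symmetric] measurable_compose[OF _ measurable_ennreal])
      (simp only: measurable_cong_sets[OF sets_gauss_law refl])
  also have "\<dots> \<le> (\<integral>\<^sup>+f. ennreal (max 0 (?D f)) \<partial>\<rho>)"
    using \<alpha> by (intro nn_integral_mono) (simp add: ennreal_leI flip: ennreal_mult')
  finally show "ennreal (real n * (1 - \<alpha>)) * (\<integral>\<^sup>+f. ennreal (renyi \<alpha> f f0) \<partial>\<rho>) \<le> ennreal B"
    using bound(1) \<rho>_eq by simp
  show "0 \<le> B" by (rule bound(2))
qed

section \<open>Risk of a minimizer against a fixed competitor\<close>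

lemma square_sum_le: "(a + b)\<^sup>2 \<le> 2 * a\<^sup>2 + 2 * b\<^sup>2" for a b :: real
  using zero_le_power2[of "a - b"] by (simp add: power2_eq_square algebra_simps)

lemma integrable_square_diff:
  assumes f: "square_integrable f" and g: "continuous_on {-1..1} g"
  shows "integrable leb (\<lambda>w. (f w - g w)\<^sup>2)"
proof (rule Bochner_Integration.integrable_bound)
  note [measurable] = continuous_imp_measurable_leb[OF g]
  have [measurable]: "f \<in> borel_measurable leb" using f by (simp add: square_integrable_def)
  have "integrable leb (\<lambda>w. (g w)\<^sup>2)"
    by (intro integrable_leb_continuous continuous_intros g)
  then show "integrable leb (\<lambda>w. 2 * (f w)\<^sup>2 + 2 * (g w)\<^sup>2)"
    using f by (simp add: square_integrable_def)
  show "AE w in leb. norm ((f w - g w)\<^sup>2) \<le> norm (2 * (f w)\<^sup>2 + 2 * (g w)\<^sup>2)"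
  proof (rule AE_I2)
    fix w
    show "norm ((f w - g w)\<^sup>2) \<le> norm (2 * (f w)\<^sup>2 + 2 * (g w)\<^sup>2)"
      using square_sum_le[of "f w" "- g w"] by simp
  qed
  show "(\<lambda>w. (f w - g w)\<^sup>2) \<in> borel_measurable leb" by measurable
qed

text \<open>For almost every sample the minimizer's objective is at most that of the competitor
  \<open>gauss_law K m v\<close>, which \<open>A\<close> bounds by an explicit function of the data.
  Taking expectations leaves the bias and variance of the competitor plus its divergence from the
  prior.\<close>

lemma oracle_inequality:
  assumes \<alpha>: "0 < \<alpha>" "\<alpha> < 1" and f0: "square_integrable f0"
    and n: "1 \<le> n" and K: "1 \<le> K" and v: "0 < v"
    and \<pi>hat: "\<And>X. X \<in> space (sample_law f0 n) \<Longrightarrow> is_var_approx \<alpha> f0 n X (\<pi>hat X)"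
  shows "(\<integral>\<^sup>+X. (\<integral>\<^sup>+f. ennreal (renyi \<alpha> f f0) \<partial>\<pi>hat X) \<partial>sample_law f0 n)
    \<le> ennreal ((\<alpha> * real n * ((\<integral>w. (f0 w - trig_sum K m w)\<^sup>2 \<partial>leb) / 4 + (real K)\<^sup>2 * v / 2)
        + (real K * ln 2 + (\<Sum>k=1..K. (v + (m k)\<^sup>2 - 1 - ln v) / 2))) / (real n * (1 - \<alpha>)))"
proof -
  let ?S = "sample_law f0 n" and ?g = "trig_sum K m" and ?c = "real n * (1 - \<alpha>)"
  define kl where "kl = real K * ln 2 + (\<Sum>k=1..K. (v + (m k)\<^sup>2 - 1 - ln v) / 2)"
  have f0m: "f0 \<in> borel_measurable leb" and f0i: "integrable leb (\<lambda>x. (f0 x)\<^sup>2)"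
    using f0 by (auto simp: square_integrable_def)
  interpret S: prob_space ?S by (rule prob_space_sample_law[OF f0m])
  have gc: "continuous_on {-1..1} ?g"
    by (rule continuous_on_eq[where f = "\<lambda>t. \<Sum>k=1..K. m k * trig k t"])
      (auto simp: trig_sum_def intro!: continuous_intros continuous_on_trig)
  have gm: "?g \<in> borel_measurable leb" by (rule continuous_imp_measurable_leb[OF gc])
  have sq: "integrable leb (\<lambda>w. (f0 w - ?g w)\<^sup>2)"
    by (rule integrable_square_diff[OF f0 gc])
  define A where "A X = \<alpha> * (\<Sum>i=1..n. excess_loss ?g f0 (X i) + (real K)\<^sup>2 * v / 2) + kl" for X
  define B where "B X = A X + enn2real (partition_fun \<alpha> f0 n X) - 1" for X
  note loss = obs_law_excess_loss[OF f0m gm sq]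
  note comp = sample_law_component[OF f0m _ loss(1)]
  have terms: "integrable ?S (\<lambda>X. excess_loss ?g f0 (X i) + (real K)\<^sup>2 * v / 2)"
    "(\<integral>X. excess_loss ?g f0 (X i) + (real K)\<^sup>2 * v / 2 \<partial>?S)
      = (\<integral>X. excess_loss ?g f0 (X i) \<partial>?S) + (real K)\<^sup>2 * v / 2" if "i \<in> {1..n}" for i
    using comp(1)[OF that] by (simp_all add: S.prob_space)
  note sums = Bochner_Integration.integrable_sum[OF terms(1)] Bochner_Integration.integral_sum[OF terms(1)]
  have A: "integrable ?S A"
    unfolding A_def by (intro Bochner_Integration.integrable_add integrable_mult_right sums(1)) auto
  have "(\<integral>X. A X \<partial>?S)
      = \<alpha> * (\<integral>X. (\<Sum>i=1..n. excess_loss ?g f0 (X i) + (real K)\<^sup>2 * v / 2) \<partial>?S) + kl"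
    unfolding A_def by (subst Bochner_Integration.integral_add)
      (auto intro!: integrable_mult_right sums(1) simp: S.prob_space)
  also have "\<dots> = \<alpha> * (\<Sum>i=1..n. (\<integral>X. excess_loss ?g f0 (X i) \<partial>?S) + (real K)\<^sup>2 * v / 2) + kl"
    by (subst sums(2)) (simp_all only: terms(2) cong: sum.cong)
  also have "(\<Sum>i=1..n. (\<integral>X. excess_loss ?g f0 (X i) \<partial>?S) + (real K)\<^sup>2 * v / 2)
      = (\<Sum>i=1..n. (\<integral>w. (f0 w - ?g w)\<^sup>2 \<partial>leb) / 4 + (real K)\<^sup>2 * v / 2)"
    by (intro sum.cong refl) (simp only: comp(2) loss(2))
  finally have EA: "(\<integral>X. A X \<partial>?S)
      = \<alpha> * real n * ((\<integral>w. (f0 w - ?g w)\<^sup>2 \<partial>leb) / 4 + (real K)\<^sup>2 * v / 2) + kl" by simp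
  note Zm = measurable_partition_fun[OF \<alpha> f0m, of n] and EZ = nn_integral_partition_fun[OF \<alpha> f0m, of n]
  \<comment> \<open>Expectation 1 forces finiteness almost surely, so the value 0 of
    \<open>enn2real\<close> at infinity does no harm.\<close>
  have Zfin: "AE X in ?S. partition_fun \<alpha> f0 n X < \<infinity>"
    using nn_integral_PInf_AE[OF Zm] EZ by (auto simp: less_top elim: eventually_mono)
  have nnZ: "(\<integral>\<^sup>+X. ennreal (enn2real (partition_fun \<alpha> f0 n X)) \<partial>?S) = 1"
    unfolding EZ[symmetric] using Zfin by (intro nn_integral_cong_AE) (auto elim!: eventually_mono)
  have Z: "integrable ?S (\<lambda>X. enn2real (partition_fun \<alpha> f0 n X))"
    by (rule integrableI_nonneg) (use Zm nnZ in auto)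
  have EZ1: "(\<integral>X. enn2real (partition_fun \<alpha> f0 n X) \<partial>?S) = 1"
    using nn_integral_eq_integral[OF Z] nnZ by simp
  \<comment> \<open>The \<open>- 1\<close> in \<open>B\<close> cancels the expectation of the
    partition function.\<close>
  have B: "integrable ?S B" and EB: "(\<integral>X. B X \<partial>?S) = (\<integral>X. A X \<partial>?S)"
    unfolding B_def[abs_def] using A Z EZ1 by (simp_all add: S.prob_space)
  have c: "0 < ?c" using n \<alpha> by simp
  have "ennreal (1 / c) * ennreal c = 1" if "0 < c" for c
    using that by (simp flip: ennreal_mult')
  note cancel = this[OF c]
  have main: "AE X in ?S. (\<integral>\<^sup>+f. ennreal (renyi \<alpha> f f0) \<partial>\<pi>hat X) \<le> ennreal (B X / ?c) \<and> 0 \<le> B X / ?c"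
    using Zfin AE_space
  proof eventually_elim
    case (elim X)
    note X = elim(2)
    have fam: "\<pi>hat X \<in> var_family" "gauss_law K m v \<in> var_family"
      using \<pi>hat[OF X] K v by (auto simp: is_var_approx_def is_arg_min_def var_family_def)
    have "var_objective \<alpha> f0 n X (\<pi>hat X) \<le> var_objective \<alpha> f0 n X (gauss_law K m v)"
      using \<pi>hat[OF X] fam(2) by (auto simp: is_var_approx_def is_arg_min_def not_less)
    also have "\<dots> \<le> A X"
      unfolding var_objective_def A_def KL_gauss_law[OF v K] gauss_law_ln_density(2)[OF v K] kl_def[symmetric]
      using gauss_law_log_lik_ratio(2)[OF v X, of K m] \<alpha> by (intro add_right_mono mult_left_mono) auto
    finally have obj: "var_objective \<alpha> f0 n X (\<pi>hat X) + enn2real (partition_fun \<alpha> f0 n X) - 1 \<le> B X"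
      by (simp add: B_def)
    note b = var_family_renyi_bound[OF \<alpha> f0m fam(1) X elim(1)]
    have "(\<integral>\<^sup>+f. ennreal (renyi \<alpha> f f0) \<partial>\<pi>hat X)
        = ennreal (1 / ?c) * (ennreal ?c * (\<integral>\<^sup>+f. ennreal (renyi \<alpha> f f0) \<partial>\<pi>hat X))"
      unfolding mult.assoc[symmetric] cancel by simp
    also have "\<dots> \<le> ennreal (1 / ?c) * ennreal (B X)"
      using b(1) ennreal_leI[OF obj] by (intro mult_left_mono) auto
    also have "\<dots> = ennreal (B X / ?c)"
      using b(2) obj c by (simp flip: ennreal_mult')
    finally show ?case using b(2) obj c by simp
  qed
  \<comment> \<open>Monotonicity of the nonnegative integral holds for arbitrary functions, so no
    measurable choice of minimizers enters.\<close>
  have "(\<integral>\<^sup>+X. (\<integral>\<^sup>+f. ennreal (renyi \<alpha> f f0) \<partial>\<pi>hat X) \<partial>?S) \<le> (\<integral>\<^sup>+X. ennreal (B X / ?c) \<partial>?S)"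
    using main by (intro nn_integral_mono_AE) (auto elim: eventually_mono)
  also have "\<dots> = ennreal (\<integral>X. B X / ?c \<partial>?S)"
    using B main by (intro nn_integral_eq_integral) (auto elim: eventually_mono)
  also have "(\<integral>X. B X / ?c \<partial>?S) = (\<integral>X. A X \<partial>?S) / ?c"
    using EB by simp
  finally show ?thesis by (simp only: EA kl_def)
qed

section \<open>Approximation error and rate\<close>

text \<open>Parseval for a finite block. With \<open>1 \<le> K\<close> the block starts at index 2
  or later, where every basis function has norm 1.\<close>

lemma integral_square_trig_partial_sum:
  assumes "1 \<le> K" "K \<le> N"
  shows "(\<integral>x. (\<Sum>k=Suc K..N. \<beta> k * trig k x)\<^sup>2 \<partial>leb) = (\<Sum>k=Suc K..N. (\<beta> k)\<^sup>2)"
proof -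
  have "(\<integral>x. (\<Sum>k=Suc K..N. \<beta> k * trig k x)\<^sup>2 \<partial>leb)
      = (\<integral>x. (\<Sum>j=Suc K..N. \<Sum>k=Suc K..N. \<beta> j * \<beta> k * (trig j x * trig k x)) \<partial>leb)"
    by (simp add: power2_eq_square sum_product mult_ac)
  also have "\<dots> = (\<Sum>j=Suc K..N. \<Sum>k=Suc K..N. \<beta> j * \<beta> k * (\<integral>x. trig j x * trig k x \<partial>leb))"
    by (simp add: Bochner_Integration.integral_sum integrable_trig_mult)
  also have "\<dots> = (\<Sum>j=Suc K..N. \<Sum>k=Suc K..N. if j = k then (\<beta> j)\<^sup>2 else 0)"
    using assms by (intro sum.cong refl) (auto simp: trig_orthogonal power2_eq_square)
  finally show ?thesis by simp
qed

text \<open>Beyond \<open>K\<close> every weight is at least \<open>Suc K powr (2 * r)\<close>. The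
  case \<open>K = 0\<close> bounds the total energy of the coefficients.\<close>

lemma sobolev_partial_sum_bound:
  fixes \<beta> :: "nat \<Rightarrow> real"
  assumes r: "0 \<le> r" and sm: "summable (\<lambda>k. real (Suc k) powr (2 * r) * (\<beta> (Suc k))\<^sup>2)"
    and R: "(\<Sum>k. real (Suc k) powr (2 * r) * (\<beta> (Suc k))\<^sup>2) \<le> R"
  shows "(\<Sum>k=Suc K..N. (\<beta> k)\<^sup>2) * real (Suc K) powr (2 * r) \<le> R"
proof -
  let ?t = "\<lambda>k. real k powr (2 * r) * (\<beta> k)\<^sup>2"
  have "(\<Sum>k=Suc K..N. (\<beta> k)\<^sup>2) * real (Suc K) powr (2 * r) \<le> (\<Sum>k=Suc K..N. ?t k)"
    unfolding sum_distrib_right using r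
    by (intro sum_mono) (subst mult.commute, auto intro!: mult_right_mono powr_mono2)
  also have "\<dots> \<le> (\<Sum>k=Suc 0..N. ?t k)"
    by (intro sum_mono2) auto
  also have "\<dots> = (\<Sum>k<N. ?t (Suc k))"
    by (rule sum.atLeast1_atMost_eq)
  also have "\<dots> \<le> (\<Sum>k. ?t (Suc k))"
    using sm by (intro sum_le_suminf) auto
  finally show ?thesis using R by simp
qed

text \<open>The error at level \<open>K\<close> is split at a larger level \<open>N\<close> into the
  error at \<open>N\<close>, which tends to 0, and a finite block controlled by the ellipsoid. The
  crude factor 2 in the splitting avoids identifying \<open>\<beta>\<close> with the Fourier
  coefficients of \<open>f0\<close>.\<close>

lemma sobolev_approximation:
  assumes r: "0 \<le> r" and f0: "f0 \<in> sobolev_ellipsoid r R"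
  obtains \<beta> where "\<And>K. (\<Sum>k=1..K. (\<beta> k)\<^sup>2) \<le> R"
    and "\<And>K. 1 \<le> K \<Longrightarrow> (\<integral>w. (f0 w - trig_sum K \<beta> w)\<^sup>2 \<partial>leb) \<le> 2 * R * real K powr (- 2 * r)"
proof -
  obtain \<beta> where lim: "(\<lambda>N. \<integral>x. (f0 x - (\<Sum>k=1..N. \<beta> k * trig k x))\<^sup>2 \<partial>leb) \<longlonglongrightarrow> 0"
    and sm: "summable (\<lambda>k. real (Suc k) powr (2 * r) * (\<beta> (Suc k))\<^sup>2)"
    and R: "(\<Sum>k. real (Suc k) powr (2 * r) * (\<beta> (Suc k))\<^sup>2) \<le> R"
    and sqi: "square_integrable f0"
    using f0 by (auto simp: sobolev_ellipsoid_def)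
  have f0m: "f0 \<in> borel_measurable leb" and f0i: "integrable leb (\<lambda>x. (f0 x)\<^sup>2)"
    using sqi by (auto simp: square_integrable_def)
  note bound = sobolev_partial_sum_bound[OF r sm R]
  let ?s = "\<lambda>N x. \<Sum>k=1..N. \<beta> k * trig k x"
  have sc: "continuous_on {-1..1} (\<lambda>x. \<Sum>k\<in>J. \<beta> k * trig k x)" for J
    by (intro continuous_intros continuous_on_trig)
  have sq: "integrable leb (\<lambda>w. (f0 w - ?s N w)\<^sup>2)" for N
    by (rule integrable_square_diff[OF sqi sc])
  have "(\<integral>w. (f0 w - trig_sum K \<beta> w)\<^sup>2 \<partial>leb) \<le> 2 * R * real K powr (- 2 * r)" if K: "1 \<le> K" for K
  proof -
    have tail: "(\<Sum>k=Suc K..N. (\<beta> k)\<^sup>2) \<le> R * real K powr (- 2 * r)" for N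
    proof -
      have "(\<Sum>k=Suc K..N. (\<beta> k)\<^sup>2) * real K powr (2 * r) \<le> (\<Sum>k=Suc K..N. (\<beta> k)\<^sup>2) * real (Suc K) powr (2 * r)"
        using r by (intro mult_left_mono powr_mono2 sum_nonneg) auto
      also note bound
      finally show ?thesis
        using K by (simp add: powr_minus field_simps)
    qed
    have le: "(\<integral>w. (f0 w - ?s K w)\<^sup>2 \<partial>leb)
        \<le> 2 * (\<integral>w. (f0 w - ?s N w)\<^sup>2 \<partial>leb) + 2 * R * real K powr (- 2 * r)" if N: "K \<le> N" for N
    proof -
      have diff: "?s N w = ?s K w + (\<Sum>k=Suc K..N. \<beta> k * trig k w)" for w
        using N sum.ub_add_nat[of 1 K "\<lambda>k. \<beta> k * trig k w" "N - K"] by simp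
      have i2: "integrable leb (\<lambda>w. (\<Sum>k=Suc K..N. \<beta> k * trig k w)\<^sup>2)"
        by (intro integrable_leb_continuous continuous_intros continuous_on_trig)
      have "(\<integral>w. (f0 w - ?s K w)\<^sup>2 \<partial>leb)
          \<le> (\<integral>w. 2 * (f0 w - ?s N w)\<^sup>2 + 2 * (\<Sum>k=Suc K..N. \<beta> k * trig k w)\<^sup>2 \<partial>leb)"
      proof (rule integral_mono[OF sq])
        show "integrable leb (\<lambda>w. 2 * (f0 w - ?s N w)\<^sup>2 + 2 * (\<Sum>k=Suc K..N. \<beta> k * trig k w)\<^sup>2)"
          using sq i2 by simp
        show "(f0 w - ?s K w)\<^sup>2 \<le> 2 * (f0 w - ?s N w)\<^sup>2 + 2 * (\<Sum>k=Suc K..N. \<beta> k * trig k w)\<^sup>2" for w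
        proof -
          have "f0 w - ?s K w = (f0 w - ?s N w) + (\<Sum>k=Suc K..N. \<beta> k * trig k w)"
            using diff[of w] by linarith
          then show ?thesis by (simp only: square_sum_le)
        qed
      qed
      also have "\<dots> = 2 * (\<integral>w. (f0 w - ?s N w)\<^sup>2 \<partial>leb) + 2 * (\<Sum>k=Suc K..N. (\<beta> k)\<^sup>2)"
        using sq i2 integral_square_trig_partial_sum[OF K N, of \<beta>] by simp
      finally show ?thesis using tail[of N] by simp
    qed
    have "(\<lambda>N. 2 * (\<integral>w. (f0 w - ?s N w)\<^sup>2 \<partial>leb) + 2 * R * real K powr (- 2 * r))
        \<longlonglongrightarrow> 2 * 0 + 2 * R * real K powr (- 2 * r)"
      by (intro tendsto_intros lim)
    then have "(\<integral>w. (f0 w - ?s K w)\<^sup>2 \<partial>leb) \<le> 2 * 0 + 2 * R * real K powr (- 2 * r)"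
      by (rule LIMSEQ_le_const) (use le in blast)
    moreover have "(\<integral>w. (f0 w - trig_sum K \<beta> w)\<^sup>2 \<partial>leb) = (\<integral>w. (f0 w - ?s K w)\<^sup>2 \<partial>leb)"
      by (intro Bochner_Integration.integral_cong) (auto simp: trig_sum_def)
    ultimately show ?thesis by simp
  qed
  moreover have "(\<Sum>k=1..K. (\<beta> k)\<^sup>2) \<le> R" for K
    using bound[of 0 K] by simp
  ultimately show thesis using that by blast
qed

text \<open>With \<open>L = ln n / n\<close>, the real number \<open>x\<close> balances squared bias
  against complexity: \<open>x powr (- 2 * r)\<close> and \<open>x * L\<close> both equal
  \<open>\<epsilon>\<close>. The bound \<open>1 \<le> \<epsilon> * n\<close> later absorbs
  constants.\<close>

lemma rate_choice:
  fixes r :: real and n :: nat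
  assumes r: "0 < r" and n: "3 \<le> n"
  defines "\<epsilon> \<equiv> (ln (real n) / real n) powr (2 * r / (2 * r + 1))"
  obtains K :: nat where "1 \<le> K" "real K powr (- 2 * r) \<le> \<epsilon>"
    "real K * ln (real n) \<le> 2 * \<epsilon> * real n" "(real K)\<^sup>2 / real n \<le> 4 * \<epsilon> * real n" "1 \<le> \<epsilon> * real n"
proof -
  define L where "L = ln (real n) / real n"
  define x where "x = L powr (- 1 / (2 * r + 1))"
  define K where "K = nat \<lceil>x\<rceil>"
  have n0: "0 < real n" using n by simp
  \<comment> \<open>Here \<open>3 \<le> n\<close> enters, as 3 exceeds \<open>exp 1\<close>.\<close>
  have ln1: "1 \<le> ln (real n)"
    using n exp_le by (subst ln_ge_iff) (auto intro: order_trans)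
  have Ln: "L * real n = ln (real n)" using n0 by (simp add: L_def)
  have L0: "0 < L" unfolding L_def using ln1 n0 by (intro divide_pos_pos) linarith+
  have L1: "L \<le> 1" using ln_bound[OF n0] n0 by (simp add: L_def)
  have x1: "1 \<le> x"
    using powr_mono'[of "- 1 / (2 * r + 1)" 0 L] r L0 L1 by (simp add: x_def)
  \<comment> \<open>Rounding up at most doubles \<open>x\<close>, because
    \<open>x \<ge> 1\<close>.\<close>
  have K: "x \<le> real K" "real K \<le> 2 * x" using x1 unfolding K_def by linarith+
  have xL: "x * L = \<epsilon>"
  proof -
    have "x * L = L powr (- 1 / (2 * r + 1)) * L powr 1" using L0 by (simp add: x_def)
    also have "\<dots> = L powr (- 1 / (2 * r + 1) + 1)" by (simp only: powr_add)
    also have "- 1 / (2 * r + 1) + 1 = 2 * r / (2 * r + 1)" using r by (simp add: field_simps)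
    finally show ?thesis by (simp add: \<epsilon>_def L_def)
  qed
  have "real K powr (- 2 * r) \<le> x powr (- 2 * r)"
    using K(1) x1 r by (intro powr_mono2') auto
  also have "\<dots> = \<epsilon>" by (simp add: x_def \<epsilon>_def powr_powr L_def)
  finally have 2: "real K powr (- 2 * r) \<le> \<epsilon>" .
  have "real K * ln (real n) \<le> 2 * x * (L * real n)"
    unfolding Ln using K(2) ln1 by (intro mult_right_mono) auto
  then have 3: "real K * ln (real n) \<le> 2 * \<epsilon> * real n"
    unfolding xL[symmetric] by (simp add: mult_ac)
  \<comment> \<open>This yields \<open>K \<le> 2 * n\<close>, so \<open>K^2 / n\<close> is dominated
    by the complexity term \<open>K * ln n\<close>.\<close>
  have "x \<le> L powr (- 1)"
    unfolding x_def using L0 L1 r by (intro powr_mono') (auto simp: field_simps)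
  also have "\<dots> \<le> real n"
    using L0 n0 ln1 n by (simp add: powr_minus_divide L_def field_simps)
  finally have xn: "real K \<le> 2 * real n" using K(2) by simp
  have "(real K)\<^sup>2 / real n = real K * (real K / real n)" by (simp add: power2_eq_square)
  also have "\<dots> \<le> real K * 2" using xn n0 by (intro mult_left_mono) (auto simp: field_simps)
  also have "\<dots> \<le> 2 * (real K * ln (real n))" using mult_left_mono[OF ln1, of "real K"] by simp
  finally have 4: "(real K)\<^sup>2 / real n \<le> 4 * \<epsilon> * real n" using 3 by simp
  have "1 \<le> L * real n" using Ln ln1 by simp
  also have "\<dots> \<le> x * L * real n" using x1 L0 n0 by (intro mult_right_mono) auto
  finally have 5: "1 \<le> \<epsilon> * real n" unfolding xL .
  have "1 \<le> K" using K(1) x1 by linarith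
  then show thesis using that 2 3 4 5 by blast
qed

theorem theorem5p1:
  fixes \<alpha> r C :: real
  assumes "0 < \<alpha>" "\<alpha> < 1" and "2 \<le> r" and "0 < C"
  shows "\<exists>B>0. \<forall>\<^sub>F n in sequentially.
    \<forall>f0 \<in> sobolev_ellipsoid r (C\<^sup>2).
    \<forall>\<pi>hat :: (nat \<Rightarrow> real \<times> real) \<Rightarrow> (real \<Rightarrow> real) measure.
      (\<forall>X \<in> space (sample_law f0 n). is_var_approx \<alpha> f0 n X (\<pi>hat X)) \<longrightarrow>
      (\<integral>\<^sup>+X. (\<integral>\<^sup>+f. ennreal (renyi \<alpha> f f0) \<partial>\<pi>hat X) \<partial>sample_law f0 n)
        \<le> ennreal (B * (ln (real n) / real n) powr (2 * r / (2 * r + 1)))"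
proof (intro exI conjI eventually_mono[OF eventually_ge_at_top[of 3]] ballI allI impI)
  \<comment> \<open>The data-fit term will contribute \<open>C^2 / 2 + 2\<close> and the divergence
    term \<open>C^2 / 2 + 4\<close>; the division by \<open>1 - \<alpha>\<close> comes from
    \<open>oracle_inequality\<close>.\<close>
  show "0 < (C\<^sup>2 + 6) / (1 - \<alpha>)"
    using assms by (simp add: add_nonneg_pos)
  fix n :: nat and f0 and \<pi>hat :: "(nat \<Rightarrow> real \<times> real) \<Rightarrow> (real \<Rightarrow> real) measure"
  assume n: "3 \<le> n" and f0: "f0 \<in> sobolev_ellipsoid r (C\<^sup>2)"
    and \<pi>hat: "\<forall>X \<in> space (sample_law f0 n). is_var_approx \<alpha> f0 n X (\<pi>hat X)"
  define \<epsilon> where "\<epsilon> = (ln (real n) / real n) powr (2 * r / (2 * r + 1))"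
  have r: "0 < r" using assms by simp
  obtain K where K: "1 \<le> K" "real K powr (- 2 * r) \<le> \<epsilon>" "real K * ln (real n) \<le> 2 * \<epsilon> * real n"
      "(real K)\<^sup>2 / real n \<le> 4 * \<epsilon> * real n" "1 \<le> \<epsilon> * real n"
    using rate_choice[OF r n] unfolding \<epsilon>_def by blast
  obtain \<beta> where \<beta>: "\<And>K. (\<Sum>k=1..K. (\<beta> k)\<^sup>2) \<le> C\<^sup>2"
    and bias: "\<And>K. 1 \<le> K \<Longrightarrow> (\<integral>w. (f0 w - trig_sum K \<beta> w)\<^sup>2 \<partial>leb) \<le> 2 * C\<^sup>2 * real K powr (- 2 * r)"
    using sobolev_approximation[OF less_imp_le[OF r] f0] by blast
  \<comment> \<open>With this variance the term \<open>n * K^2 * v / 2\<close> is only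
    \<open>K^2 / (2 * n)\<close>, while the divergence pays \<open>- ln v / 2 = ln n\<close> per
    coordinate.\<close>
  define v where "v = 1 / (real n)\<^sup>2"
  define I where "I = (\<integral>w. (f0 w - trig_sum K \<beta> w)\<^sup>2 \<partial>leb)"
  have n0: "1 \<le> real n" and v: "0 < v" "v \<le> 1" using n by (auto simp: v_def)
  have ln_v: "ln v = - 2 * ln (real n)"
    using n by (simp add: v_def ln_div ln_realpow)
  have "I \<le> 2 * C\<^sup>2 * \<epsilon>"
    using bias[OF K(1)] mult_left_mono[OF K(2), of "2 * C\<^sup>2"] unfolding I_def by simp
  moreover have "real n * ((real K)\<^sup>2 * v) = (real K)\<^sup>2 / real n"
    using n by (simp add: v_def power2_eq_square)
  ultimately have fit: "real n * (I / 4 + (real K)\<^sup>2 * v / 2) \<le> real n * (C\<^sup>2 * \<epsilon> / 2) + 2 * \<epsilon> * real n"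
    using K(4) mult_left_mono[of I "2 * C\<^sup>2 * \<epsilon>" "real n"] by (simp add: distrib_left)
  have "0 \<le> I" unfolding I_def by (rule Bochner_Integration.integral_nonneg) simp
  then have "\<alpha> * (real n * (I / 4 + (real K)\<^sup>2 * v / 2)) \<le> real n * (I / 4 + (real K)\<^sup>2 * v / 2)"
    using assms v by (intro mult_left_le_one_le) auto
  with fit have fit: "\<alpha> * real n * (I / 4 + (real K)\<^sup>2 * v / 2) \<le> real n * (C\<^sup>2 * \<epsilon> / 2) + 2 * \<epsilon> * real n"
    by (simp add: mult.assoc)
  have "(\<Sum>k=1..K. (v + (\<beta> k)\<^sup>2 - 1 - ln v) / 2) \<le> (\<Sum>k=1..K. (\<beta> k)\<^sup>2 / 2 + ln (real n))"
    using v by (intro sum_mono) (simp add: ln_v field_simps)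
  also have "\<dots> = (\<Sum>k=1..K. (\<beta> k)\<^sup>2) / 2 + real K * ln (real n)"
    by (simp add: sum.distrib sum_divide_distrib)
  also have "\<dots> \<le> C\<^sup>2 / 2 + real K * ln (real n)" using \<beta>[of K] by simp
  \<comment> \<open>The dimension cost \<open>K * ln 2\<close> is at most another
    \<open>K * ln n\<close>.\<close>
  finally have "real K * ln 2 + (\<Sum>k=1..K. (v + (\<beta> k)\<^sup>2 - 1 - ln v) / 2)
      \<le> C\<^sup>2 / 2 * 1 + 2 * (real K * ln (real n))"
    using mult_left_mono[of "ln 2" "ln (real n)" "real K"] n by simp
  \<comment> \<open>The constant is turned into a multiple of the rate by
    \<open>1 \<le> \<epsilon> * real n\<close>.\<close>
  also have "\<dots> \<le> C\<^sup>2 / 2 * (\<epsilon> * real n) + 2 * (2 * \<epsilon> * real n)"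
    using K by (intro add_mono mult_left_mono) auto
  finally have "(\<alpha> * real n * (I / 4 + (real K)\<^sup>2 * v / 2)
      + (real K * ln 2 + (\<Sum>k=1..K. (v + (\<beta> k)\<^sup>2 - 1 - ln v) / 2))) \<le> (C\<^sup>2 + 6) * \<epsilon> * real n"
    using fit by (simp add: algebra_simps)
  then have "(\<alpha> * real n * (I / 4 + (real K)\<^sup>2 * v / 2)
      + (real K * ln 2 + (\<Sum>k=1..K. (v + (\<beta> k)\<^sup>2 - 1 - ln v) / 2))) / (real n * (1 - \<alpha>))
      \<le> (C\<^sup>2 + 6) * \<epsilon> * real n / (real n * (1 - \<alpha>))"
    using assms n0 by (intro divide_right_mono) auto
  also have "\<dots> = (C\<^sup>2 + 6) / (1 - \<alpha>) * \<epsilon>" using n0 by simp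
  finally have le: "(\<alpha> * real n * (I / 4 + (real K)\<^sup>2 * v / 2)
      + (real K * ln 2 + (\<Sum>k=1..K. (v + (\<beta> k)\<^sup>2 - 1 - ln v) / 2))) / (real n * (1 - \<alpha>))
      \<le> (C\<^sup>2 + 6) / (1 - \<alpha>) * \<epsilon>" .
  have sq: "square_integrable f0" using f0 by (simp add: sobolev_ellipsoid_def)
  have n1: "1 \<le> n" using n by simp
  have "(\<integral>\<^sup>+X. (\<integral>\<^sup>+f. ennreal (renyi \<alpha> f f0) \<partial>\<pi>hat X) \<partial>sample_law f0 n)
    \<le> ennreal ((\<alpha> * real n * (I / 4 + (real K)\<^sup>2 * v / 2)
      + (real K * ln 2 + (\<Sum>k=1..K. (v + (\<beta> k)\<^sup>2 - 1 - ln v) / 2))) / (real n * (1 - \<alpha>)))"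
    unfolding I_def using \<pi>hat by (intro oracle_inequality[OF assms(1,2) sq n1 K(1) v(1)]) auto
  also note ennreal_leI[OF le]
  finally show "(\<integral>\<^sup>+X. (\<integral>\<^sup>+f. ennreal (renyi \<alpha> f f0) \<partial>\<pi>hat X) \<partial>sample_law f0 n)
      \<le> ennreal ((C\<^sup>2 + 6) / (1 - \<alpha>) * (ln (real n) / real n) powr (2 * r / (2 * r + 1)))"
    by (simp only: \<epsilon>_def)
qed

end
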